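(* Let $\mathcal{M}$ be a semi-Markovian causal model with causal graph $\mathcal{G}$, observed variables $\mathcal{V} = \{\mathbf{x}, t, y\}$ (features $\mathbf{x}$, treatment $t$, outcome $y$) and unobserved variables $\mathcal{U}$. Suppose that (1) the outcome $y$ is a descendant of the treatment $t$; (2) there is an unobserved confounder between the outcome $y$ and the treatment $t$; (3) $\mathbf{b}$, the set of all children of the treatment $t$, is observed and known. Let $\mathbf{z} \subseteq \mathcal{V} \setminus \{t, \mathbf{b}, y\}$ be a set such that $\mathbf{b}$ and $y$ are d-separated by $\{t\} \cup \mathbf{z}$ in $\mathcal{G}$, and such that $\mathbf{z}$ can be decomposed into $\mathbf{z}^{(o)} \subseteq \mathbf{z}$ and $\mathbf{z}^{(i)} = \mathbf{z} \setminus \mathbf{z}^{(o)}$ with (i) $\mathbf{z}^{(i)}$ and $t$ d-separated (by the empty set) in $\mathcal{G}$, and (ii) $\mathbf{z}^{(o)}$ and $t$ d-separated by $\mathbf{b} \cup \mathbf{z}^{(i)}$ in $\mathcal{G}$. Then $\mathbf{z}$ and $\mathbf{s} := (\mathbf{b}, \mathbf{z}^{(i)})$ are generalized front-doors, and the causal effect of $t$ on $y$ can be obtained using any of the following equivalent formulae: $$\mathbb{P}(y \mid do(t = \tau)) = \sum_{z} \Big( \sum_{t'} \mathbb{P}(y \mid \mathbf{z} = z, t = t')\, \mathbb{P}(t = t') \Big) \mathbb{P}(\mathbf{z} = z \mid t = \tau),$$ $$\mathbb{P}(y \mid do(t = \tau)) = \sum_{s} \Big( \sum_{t'} \mathbb{P}(y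 \mid \mathbf{s} = s, t = t')\, \mathbb{P}(t = t') \Big) \mathbb{P}(\mathbf{s} = s \mid t = \tau).$$
   Context: Semi-Markovian causal model (SMCM). Let $\mathcal{W} = \mathcal{V} \cup \mathcal{U}$, with $\mathcal{V}$ the set of observed variables and $\mathcal{U}$ the set of unobserved variables. An SMCM is specified as follows: - $\mathcal{G}$ is a directed acyclic graph over the vertex set $\mathcal{W}$ such that no element of $\mathcal{U}$ has parents; - for $v \in \mathcal{V}$, $\pi^{(o)}(v) \subseteq \mathcal{V}$ and $\pi^{(u)}(v) \subseteq \mathcal{U}$ denote the sets of parents of $v$ in $\mathcal{V}$ and in $\mathcal{U}$; - $\mathbb{P}(\mathbf{u})$ is the joint distribution of the unobserved variables; - the observational distribution is $\mathbb{P}(\mathbf{v}) = \mathbb{E}_{\mathbf{u}}\big[\prod_{v \in \mathcal{V}} \mathbb{P}(v \mid \pi^{(o)}(v), \pi^{(u)}(v))\big]$; - the interventional distribution when the variables $\mathbf{r} \subset \mathcal{V}$ are set to the fixed value $r$ is $\mathbb{P}(\mathbf{v} \mid do(\mathbf{r} = r)) = \mathbf{1}_{\mathbf{r} = r} \cdot \mathbb{E}_{\mathbf{u}}\big[\prod_{v \in \mathcal{V} \setminus \mathbf{r}} \mathbb{P}(v \mid \pi^{(o)}(v), \pi^{(u)}(v))\big]$; - for $v_1, v_2 \in \mathcal{V}$, if $\pi^{(u)}(v_1) \cap \pi^{(u)}(v_2) \neq \emptyset$, then $v_1$ and $v_2$ have a bi-directed edge $v_1 \leftrightarrow v_2$ in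 $\mathcal{G}$. Hypothesis (2) says that $t \leftrightarrow y$. Causal effect. The causal effect of $t$ (when forced to a value $\tau$) on $y$ is $\mathbb{P}(y \mid do(t=\tau)) = \sum_{\mathbf{v} \setminus \{y\}} \mathbb{P}(\mathbf{v} \setminus \{y\}, y \mid do(t=\tau))$. Probabilities on the right-hand sides of the two formulae are with respect to the observational distribution. Generalized front-door: a set for which the front-door adjustment formula (the displayed formula with that set as adjustment set) gives the causal effect, as if the set were a traditional front-door set. d-separation. A path is an ordered sequence of distinct nodes, each joined to the next by an edge. A path between $w_1$ and $w_2$ is blocked by a set $\mathbf{w} \subset \mathcal{W} \setminus \{w_1, w_2\}$ if some node $w$ on it satisfies either (a) $w$ is not a collider on the path and $w \in \mathbf{w}$, or (b) $w$ is a collider on the path and neither $w$ nor any of its descendants is in $\mathbf{w}$. Nodes $w_1$ and $w_2$ are d-separated by $\mathbf{w}$ in $\mathcal{G}$ if $\mathbf{w}$ blocks every path between them; sets are d-separated if every pair of elements, one from each set, is. Standing assumption (causal faithfulness): any conditional independence of $w_1$ and $w_2$ given $\mathbf{w}$ implies that $w_1$ and $w_2$ are d-separated by $\mathbf{w}$ in $\mathcal{G}$.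
   Formalization: The unobserved variables are taken to be mutually independent (the joint law factorises along the causal graph), without which the claim fails; observed variables are discrete and the conditional probabilities in both formulae are assumed to be defined. *)

theory Defs
  imports "HOL-Probability.Probability"
begin

section \<open>Semi-Markovian causal models\<close>

text \<open>
  Nodes have type \<open>'n\<close>. All observed variables take values in one countable type \<open>'b\<close> (a variable
  may use only part of it), so that the sums over values below make sense. The unobserved variables
  take values in arbitrary measurable spaces on \<open>'c\<close>.
  An assignment of values to a set \<open>A\<close> of observed variables is an element of \<open>PiE A (\<lambda>_. UNIV)\<close>.
\<close>

record ('n, 'b, 'c) smcm =
  observed :: "'n set"
  unobserved :: "'n set"
  edges :: "('n \<times> 'n) set"
  latent_space :: "'n \<Rightarrow> 'c measure"
  latent_law :: "('n \<Rightarrow> 'c) measure"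
  kernel :: "'n \<Rightarrow> ('n \<Rightarrow> 'b) \<Rightarrow> ('n \<Rightarrow> 'c) \<Rightarrow> 'b pmf"

definition nodes :: "('n, 'b, 'c) smcm \<Rightarrow> 'n set" where
  "nodes M = observed M \<union> unobserved M"

definition obs_parents :: "('n, 'b, 'c) smcm \<Rightarrow> 'n \<Rightarrow> 'n set" where
  "obs_parents M v = {w \<in> observed M. (w, v) \<in> edges M}"

definition unobs_parents :: "('n, 'b, 'c) smcm \<Rightarrow> 'n \<Rightarrow> 'n set" where
  "unobs_parents M v = {w \<in> unobserved M. (w, v) \<in> edges M}"

definition children :: "('n, 'b, 'c) smcm \<Rightarrow> 'n \<Rightarrow> 'n set" where
  "children M v = {w \<in> nodes M. (v, w) \<in> edges M}"

definition descendant :: "('n, 'b, 'c) smcm \<Rightarrow> 'n \<Rightarrow> 'n \<Rightarrow> bool" where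
  "descendant M w v \<longleftrightarrow> (v, w) \<in> (edges M)\<^sup>+"

text \<open>The bi-directed edge \<open>v \<leftrightarrow> w\<close>.\<close>

definition bidirected :: "('n, 'b, 'c) smcm \<Rightarrow> 'n \<Rightarrow> 'n \<Rightarrow> bool" where
  "bidirected M v w \<longleftrightarrow> unobs_parents M v \<inter> unobs_parents M w \<noteq> {}"

text \<open>
  The last condition says that the joint law of the unobserved variables factorises along the graph.
  As these variables are roots of the graph, this means that they are mutually independent;
  dependence between observed variables that is due to confounding is expressed by shared
  unobserved parents. Without it, d-separation would not entail conditional independence.
\<close>

definition semi_markovian :: "('n, 'b :: countable, 'c) smcm \<Rightarrow> bool" where
  "semi_markovian M \<longleftrightarrow>
     finite (observed M) \<and> finite (unobserved M) \<and> observed M \<inter> unobserved M = {} \<and>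
     edges M \<subseteq> nodes M \<times> nodes M \<and> acyclic (edges M) \<and>
     (\<forall>u\<in>unobserved M. \<forall>w. (w, u) \<notin> edges M) \<and>
     (\<forall>v\<in>observed M. \<forall>x\<in>PiE (obs_parents M v) (\<lambda>_. UNIV). \<forall>c.
        (\<lambda>u. pmf (kernel M v x u) c)
          \<in> borel_measurable (PiM (unobs_parents M v) (latent_space M))) \<and>
     prob_space (latent_law M) \<and>
     sets (latent_law M) = sets (PiM (unobserved M) (latent_space M)) \<and>
     prob_space.indep_vars (latent_law M) (latent_space M) (\<lambda>w u. u w) (unobserved M)"

definition mechanism :: "('n, 'b, 'c) smcm \<Rightarrow> 'n \<Rightarrow> ('n \<Rightarrow> 'b) \<Rightarrow> ('n \<Rightarrow> 'c) \<Rightarrow> real" where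
  "mechanism M v x u =
     pmf (kernel M v (restrict x (obs_parents M v)) (restrict u (unobs_parents M v))) (x v)"

definition obs_prob :: "('n, 'b, 'c) smcm \<Rightarrow> ('n \<Rightarrow> 'b) \<Rightarrow> real" where
  "obs_prob M x = (\<integral>u. (\<Prod>v\<in>observed M. mechanism M v x u) \<partial>latent_law M)"

definition obs_law :: "('n, 'b, 'c) smcm \<Rightarrow> ('n \<Rightarrow> 'b) measure" where
  "obs_law M =
     density (count_space (PiE (observed M) (\<lambda>_. UNIV))) (\<lambda>x. ennreal (obs_prob M x))"

text \<open>The probability of \<open>x\<close> when the variables in \<open>r\<close> are set to the values given by \<open>rv\<close>.\<close>

definition do_prob ::
  "('n, 'b, 'c) smcm \<Rightarrow> 'n set \<Rightarrow> ('n \<Rightarrow> 'b) \<Rightarrow> ('n \<Rightarrow> 'b) \<Rightarrow> real" where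
  "do_prob M r rv x =
     of_bool (\<forall>v\<in>r. x v = rv v) *
     (\<integral>u. (\<Prod>v\<in>observed M - r. mechanism M v x u) \<partial>latent_law M)"

text \<open>The causal effect \<open>P(y = \<eta> | do(t = \<tau>))\<close>.\<close>

definition causal_effect :: "('n, 'b, 'c) smcm \<Rightarrow> 'n \<Rightarrow> 'n \<Rightarrow> 'b \<Rightarrow> 'b \<Rightarrow> real" where
  "causal_effect M t y \<tau> \<eta> =
     (\<Sum>\<^sub>\<infinity>x\<in>{x \<in> PiE (observed M) (\<lambda>_. UNIV). x y = \<eta>}. do_prob M {t} (\<lambda>_. \<tau>) x)"


section \<open>d-separation\<close>

text \<open>
  Paths run through the directed graph on all nodes, so that \<open>v \<leftrightarrow> w\<close> is traversed through a common
  unobserved parent of \<open>v\<close> and \<open>w\<close>. As the graph is acyclic, the nodes of a path determine its edges.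
  A single node is a path from that node to itself; it is not blocked by a set that does not
  contain it, hence sets that are d-separated by a set disjoint from them have no common element.
\<close>

definition path_between :: "('n, 'b, 'c) smcm \<Rightarrow> 'n \<Rightarrow> 'n \<Rightarrow> 'n list \<Rightarrow> bool" where
  "path_between M v w p \<longleftrightarrow>
     p \<noteq> [] \<and> hd p = v \<and> last p = w \<and> distinct p \<and> set p \<subseteq> nodes M \<and>
     (\<forall>i. Suc i < length p \<longrightarrow> (p ! i, p ! Suc i) \<in> edges M \<or> (p ! Suc i, p ! i) \<in> edges M)"

definition collider_at :: "('n, 'b, 'c) smcm \<Rightarrow> 'n list \<Rightarrow> nat \<Rightarrow> bool" where
  "collider_at M p i \<longleftrightarrow>
     0 < i \<and> Suc i < length p \<and>
     (p ! (i - 1), p ! i) \<in> edges M \<and> (p ! Suc i, p ! i) \<in> edges M"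

definition blocked :: "('n, 'b, 'c) smcm \<Rightarrow> 'n set \<Rightarrow> 'n list \<Rightarrow> bool" where
  "blocked M C p \<longleftrightarrow>
     (\<exists>i<length p.
        (\<not> collider_at M p i \<and> p ! i \<in> C) \<or>
        (collider_at M p i \<and> p ! i \<notin> C \<and> (\<forall>d. descendant M d (p ! i) \<longrightarrow> d \<notin> C)))"

definition d_separated :: "('n, 'b, 'c) smcm \<Rightarrow> 'n set \<Rightarrow> 'n set \<Rightarrow> 'n set \<Rightarrow> bool" where
  "d_separated M A B C \<longleftrightarrow>
     (\<forall>a\<in>A. \<forall>b\<in>B. \<forall>p. path_between M a b p \<longrightarrow> blocked M C p)"


section \<open>Causal faithfulness\<close>

text \<open>
  The joint law of all variables, on pairs of an assignment to the unobserved variables and an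
  assignment to the observed variables.
\<close>

definition joint_law :: "('n, 'b, 'c) smcm \<Rightarrow> (('n \<Rightarrow> 'c) \<times> ('n \<Rightarrow> 'b)) measure" where
  "joint_law M =
     density (latent_law M \<Otimes>\<^sub>M count_space (PiE (observed M) (\<lambda>_. UNIV)))
       (\<lambda>(u, x). ennreal (\<Prod>v\<in>observed M. mechanism M v x u))"

text \<open>The events that depend on the variable \<open>w\<close> only.\<close>

definition node_events ::
  "('n, 'b, 'c) smcm \<Rightarrow> 'n \<Rightarrow> (('n \<Rightarrow> 'c) \<times> ('n \<Rightarrow> 'b)) set set" where
  "node_events M w =
     (if w \<in> unobserved M
      then {{(u, x) \<in> space (joint_law M). u w \<in> S} | S. S \<in> sets (latent_space M w)}
      else {{(u, x) \<in> space (joint_law M). x w \<in> S} | S. True})"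

definition sigma_of ::
  "('n, 'b, 'c) smcm \<Rightarrow> 'n set \<Rightarrow> (('n \<Rightarrow> 'c) \<times> ('n \<Rightarrow> 'b)) measure" where
  "sigma_of M C = sigma (space (joint_law M)) (\<Union>w\<in>C. node_events M w)"

definition cond_independent :: "('n, 'b, 'c) smcm \<Rightarrow> 'n \<Rightarrow> 'n \<Rightarrow> 'n set \<Rightarrow> bool" where
  "cond_independent M v w C \<longleftrightarrow>
     (\<forall>A\<in>node_events M v. \<forall>B\<in>node_events M w. AE \<omega> in joint_law M.
        real_cond_exp (joint_law M) (sigma_of M C) (indicator (A \<inter> B)) \<omega> =
        real_cond_exp (joint_law M) (sigma_of M C) (indicator A) \<omega> *
        real_cond_exp (joint_law M) (sigma_of M C) (indicator B) \<omega>)"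

definition faithful :: "('n, 'b, 'c) smcm \<Rightarrow> bool" where
  "faithful M \<longleftrightarrow>
     (\<forall>v\<in>nodes M. \<forall>w\<in>nodes M. \<forall>C. v \<noteq> w \<and> C \<subseteq> nodes M - {v, w} \<and>
        cond_independent M v w C \<longrightarrow> d_separated M {v} {w} C)"


section \<open>Front-door adjustment\<close>

abbreviation agrees :: "'n set \<Rightarrow> ('n \<Rightarrow> 'b) \<Rightarrow> ('n \<Rightarrow> 'b) \<Rightarrow> bool" where
  "agrees A a x \<equiv> \<forall>v\<in>A. x v = a v"

definition front_door_formula ::
  "('n, 'b, 'c) smcm \<Rightarrow> 'n set \<Rightarrow> 'n \<Rightarrow> 'n \<Rightarrow> 'b \<Rightarrow> 'b \<Rightarrow> real" where
  "front_door_formula M A t y \<tau> \<eta> =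
     (\<Sum>\<^sub>\<infinity>a\<in>PiE A (\<lambda>_. UNIV).
        (\<Sum>\<^sub>\<infinity>\<tau>'. \<P>(x in obs_law M. x y = \<eta> \<bar> agrees A a x \<and> x t = \<tau>') *
               \<P>(x in obs_law M. x t = \<tau>')) *
        \<P>(x in obs_law M. agrees A a x \<bar> x t = \<tau>))"

text \<open>
  Conditional probabilities given a null event are undefined on paper and \<open>0\<close> here. The following
  condition says that every \<open>P(y | A = a, t = \<tau>')\<close> which enters the formula with a non-zero weight
  \<open>P(t = \<tau>') P(A = a | t = \<tau>)\<close> is defined; it is implied by positivity of the observational
  distribution.
\<close>

definition adjustment_defined :: "('n, 'b, 'c) smcm \<Rightarrow> 'n set \<Rightarrow> 'n \<Rightarrow> bool" where
  "adjustment_defined M A t \<longleftrightarrow>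
     (\<forall>a\<in>PiE A (\<lambda>_. UNIV). \<forall>\<tau> \<tau>'.
        \<P>(x in obs_law M. agrees A a x \<and> x t = \<tau>) > 0 \<and> \<P>(x in obs_law M. x t = \<tau>') > 0 \<longrightarrow>
        \<P>(x in obs_law M. agrees A a x \<and> x t = \<tau>') > 0)"

definition generalized_front_door ::
  "('n, 'b, 'c) smcm \<Rightarrow> 'n set \<Rightarrow> 'n \<Rightarrow> 'n \<Rightarrow> bool" where
  "generalized_front_door M A t y \<longleftrightarrow>
     (\<forall>\<tau> \<eta>. \<P>(x in obs_law M. x t = \<tau>) > 0 \<longrightarrow>
        causal_effect M t y \<tau> \<eta> = front_door_formula M A t y \<tau> \<eta>)"

end

theory Submission
  imports Defs
begin

text \<open>
  Let \<open>s = b \<union> zi\<close>, and let \<open>P\<^sub>\<tau>\<close> be the law of the single-world intervention model, in which \<open>t\<close> keeps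
  its own mechanism but its children receive the value \<open>\<tau>\<close>. The causal effect is the law of \<open>y\<close> under
  \<open>P\<^sub>\<tau>\<close>, and \<open>P\<^sub>\<tau>\<close> agrees with the observational law \<open>P\<close> on the event \<open>t = \<tau>\<close>.

  In the intervention graph \<open>t\<close> and \<open>s\<close> have no common ancestor, so that \<open>t\<close> and \<open>s\<close> are independent under
  \<open>P\<^sub>\<tau>\<close> and \<open>P(s | t = \<tau>) = P\<^sub>\<tau>(s)\<close>. Moreover \<open>P\<^sub>\<tau>(y | s, t = t')\<close> does not depend on \<open>\<tau>\<close>, hence equals
  \<open>P(y | s, t = t')\<close>. Both facts come from the separation hypotheses by tracing open walks, and together
  they give the formula for \<open>s\<close> term by term. The formula for \<open>z\<close> reduces to it by the global Markov
  property: \<open>y\<close> is independent of \<open>b\<close> given \<open>t\<close> and \<open>z\<close>, and \<open>zo\<close> is independent of \<open>t\<close> given \<open>s\<close>.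

  The Markov property itself is a factorization. For an ancestral set of variables, the mechanisms whose
  families meet the set of nodes \<open>d\<close>-connected to \<open>A\<close> given \<open>C\<close> share only variables of \<open>C\<close> with the
  remaining ones, and the unobserved variables are independent.
\<close>

section \<open>Open walks\<close>

definition ancestors :: "('n \<times> 'n) set \<Rightarrow> 'n set \<Rightarrow> 'n set" where
  "ancestors E S = {v. \<exists>s\<in>S. (v, s) \<in> E\<^sup>*}"

lemma ancestors_Un: "ancestors E (S \<union> T) = ancestors E S \<union> ancestors E T"
  by (auto simp: ancestors_def)

lemma subset_ancestors: "S \<subseteq> ancestors E S"
  by (auto simp: ancestors_def)

lemma ancestors_step: "(v, w) \<in> E \<Longrightarrow> w \<in> ancestors E S \<Longrightarrow> v \<in> ancestors E S"
  by (auto simp: ancestors_def intro: converse_rtrancl_into_rtrancl)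

lemma ancestors_mono: "E \<subseteq> E' \<Longrightarrow> S \<subseteq> S' \<Longrightarrow> ancestors E S \<subseteq> ancestors E' S'"
  using rtrancl_mono[of E E'] unfolding ancestors_def by blast

lemma ancestors_idem: "v \<in> ancestors E {w} \<Longrightarrow> w \<in> ancestors E S \<Longrightarrow> v \<in> ancestors E S"
  by (auto simp: ancestors_def intro: rtrancl_trans)

text \<open>Nodes may repeat, unlike in \<open>path_between\<close>, so that a walk can be extended
  without checking distinctness; repetitions are cut out afterwards.\<close>

definition walk :: "('n, 'b, 'c) smcm \<Rightarrow> 'n list \<Rightarrow> bool" where
  "walk M p \<longleftrightarrow> p \<noteq> [] \<and> set p \<subseteq> nodes M \<and>
     (\<forall>i. Suc i < length p \<longrightarrow> (p ! i, p ! Suc i) \<in> edges M \<or> (p ! Suc i, p ! i) \<in> edges M)"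

text \<open>The negation, position by position, of the condition in \<open>blocked\<close>.
  Reflexivity of \<open>ancestors\<close> merges the two ways in which a collider is opened.\<close>

definition open_at :: "('n, 'b, 'c) smcm \<Rightarrow> 'n set \<Rightarrow> 'n list \<Rightarrow> nat \<Rightarrow> bool" where
  "open_at M C p i \<longleftrightarrow>
     (if collider_at M p i then p ! i \<in> ancestors (edges M) C else p ! i \<notin> C)"

lemma not_blocked_iff: "\<not> blocked M C p \<longleftrightarrow> (\<forall>i<length p. open_at M C p i)"
proof -
  have *: "v \<in> ancestors (edges M) C \<longleftrightarrow> v \<in> C \<or> (\<exists>d. descendant M d v \<and> d \<in> C)" for v
    unfolding ancestors_def descendant_def rtrancl_eq_or_trancl by auto
  show ?thesis
    unfolding blocked_def open_at_def * by auto
qed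

text \<open>A directed stretch of an open walk leads down to a collider, hence to \<open>C\<close>, unless it runs on
  to the end.\<close>

lemma directed_stretch:
  assumes "walk M p" and "\<And>k. k < length p \<Longrightarrow> open_at M C p k"
    and "i < j" and "j < length p" and "(p ! i, p ! Suc i) \<in> edges M"
    and "(p ! j, p ! (j - 1)) \<in> edges M" and "acyclic (edges M)"
  shows "p ! i \<in> ancestors (edges M) C"
  using assms(3,5)
proof (induction "j - i" arbitrary: i)
  case 0
  then show ?case by simp
next
  case (Suc n)
  \<comment> \<open>Otherwise the single edge between positions \<open>i\<close> and
    \<open>j\<close> would point both ways.\<close>
  have neq: "Suc i \<noteq> j"
  proof
    assume "Suc i = j"
    then have "(p ! j, p ! i) \<in> edges M" "(p ! i, p ! j) \<in> edges M"
      using Suc.prems assms(6) by auto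
    then show False
      using assms(7) unfolding acyclic_def by (meson r_into_trancl trancl_trans)
  qed
  with Suc have lt: "Suc i < j" "Suc (Suc i) < length p"
    using assms(4) by auto
  then have "(p ! Suc i, p ! Suc (Suc i)) \<in> edges M \<or> (p ! Suc (Suc i), p ! Suc i) \<in> edges M"
    using assms(1) unfolding walk_def by blast
  moreover have "p ! Suc i \<in> ancestors (edges M) C"
    if "(p ! Suc i, p ! Suc (Suc i)) \<in> edges M"
    using Suc.hyps(1)[of "Suc i"] Suc.hyps(2) lt that by auto
  moreover have "p ! Suc i \<in> ancestors (edges M) C"
    if "(p ! Suc (Suc i), p ! Suc i) \<in> edges M"
  proof -
    have "collider_at M p (Suc i)"
      using that lt Suc.prems by (auto simp: collider_at_def)
    then show ?thesis
      using assms(2)[of "Suc i"] lt by (auto simp: open_at_def)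
  qed
  ultimately show ?case
    using Suc.prems(2) ancestors_step[of "p ! i" "p ! Suc i"] by blast
qed

text \<open>Cutting out the loop between two visits changes the neighbours of the junction only. If
  the junction becomes a collider, either it was one at a visit or the loop supplies a directed path
  to \<open>C\<close>; if it lies in \<open>C\<close>, both visits were colliders and so is the
  junction.\<close>

lemma open_walk_shortcut:
  assumes w: "walk M p" and op: "\<And>k. k < length p \<Longrightarrow> open_at M C p k"
    and ij: "i < j" "j < length p" "p ! i = p ! j" and ac: "acyclic (edges M)"
  defines "q \<equiv> take i p @ drop j p"
  shows "walk M q" and "\<And>k. k < length q \<Longrightarrow> open_at M C q k"
proof -
  have len: "length q = length p - (j - i)"
    using ij by (auto simp: q_def)
  have q1: "q ! k = p ! k" if "k \<le> i" for k
    using that ij by (cases "k = i") (auto simp: q_def nth_append)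
  have q2: "q ! k = p ! (k + (j - i))" if "i \<le> k" for k
    using that ij by (auto simp: q_def nth_append add.commute)
  have asym: "(a, c) \<in> edges M \<Longrightarrow> (c, a) \<notin> edges M" for a c
    using ac unfolding acyclic_def by (meson r_into_trancl trancl_trans)
  show "walk M q"
    unfolding walk_def
  proof (intro conjI allI impI)
    show "q \<noteq> []" using ij by (auto simp: q_def)
    have "set q \<subseteq> set p"
      unfolding q_def by (auto dest: in_set_takeD in_set_dropD)
    then show "set q \<subseteq> nodes M"
      using w unfolding walk_def by blast
    fix k assume k: "Suc k < length q"
    show "(q ! k, q ! Suc k) \<in> edges M \<or> (q ! Suc k, q ! k) \<in> edges M"
    proof (cases "k < i")
      case True
      then show ?thesis using w q1[of k] q1[of "Suc k"] ij
        by (auto simp: walk_def)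
    next
      case False
      then have "Suc (k + (j - i)) < length p" using k len by auto
      then show ?thesis using w q2[of k] q2[of "Suc k"] False
        by (auto simp: walk_def)
    qed
  qed
  fix k assume k: "k < length q"
  consider "k < i" | "i < k" | "k = i" by linarith
  then show "open_at M C q k"
  proof cases
    case 1
    then have "open_at M C q k = open_at M C p k"
      using q1[of k] q1[of "Suc k"] q1[of "k - 1"] k len ij
      by (auto simp: open_at_def collider_at_def)
    then show ?thesis using op[of k] 1 ij by auto
  next
    case 2
    then have "open_at M C q k = open_at M C p (k + (j - i))"
      using q2[of k] q2[of "Suc k"] q2[of "k - 1"] k len ij
      by (auto simp: open_at_def collider_at_def)
    then show ?thesis using op[of "k + (j - i)"] k len by auto
  next
    case 3
    have qi: "q ! i = p ! i" "q ! i = p ! j" using q1[of i] q2[of i] ij by auto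
    have before: "q ! (i - 1) = p ! (i - 1)" using q1[of "i - 1"] by auto
    have after: "q ! Suc i = p ! Suc j" using q2[of "Suc i"] ij by auto
    have oi: "open_at M C p i" and oj: "open_at M C p j" using op ij by auto
    show ?thesis
    proof (cases "collider_at M q i")
      case True
      then have e: "0 < i" "Suc j < length p" "(p ! (i - 1), p ! i) \<in> edges M"
          "(p ! Suc j, p ! j) \<in> edges M"
        using qi before after len ij by (auto simp: collider_at_def)
      have "p ! i \<in> ancestors (edges M) C"
      proof (cases "collider_at M p i \<or> collider_at M p j")
        case True
        then show ?thesis using oi oj ij(3) by (auto simp: open_at_def)
      next
        case False
        \<comment> \<open>Neither visit is a collider although the outer edges point in, so both
          ends of the loop point away from the node and \<open>directed_stretch\<close>
          applies.\<close>
        have "(p ! Suc i, p ! i) \<notin> edges M" "(p ! (j - 1), p ! j) \<notin> edges M"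
          using False e ij by (auto simp: collider_at_def)
        moreover have "Suc i < length p" using ij by simp
        then have "(p ! i, p ! Suc i) \<in> edges M \<or> (p ! Suc i, p ! i) \<in> edges M"
          using w unfolding walk_def by blast
        moreover have "Suc (j - 1) < length p" using ij by simp
        then have "(p ! (j - 1), p ! Suc (j - 1)) \<in> edges M \<or> (p ! Suc (j - 1), p ! (j - 1)) \<in> edges M"
          using w unfolding walk_def by blast
        ultimately have "(p ! i, p ! Suc i) \<in> edges M" "(p ! j, p ! (j - 1)) \<in> edges M"
          using ij by auto
        then show ?thesis using directed_stretch[OF w op ij(1,2)] ac by blast
      qed
      then show ?thesis using True 3 qi by (auto simp: open_at_def)
    next
      case False
      have "p ! i \<notin> C"
      proof (rule ccontr)
        assume "\<not> ?thesis"
        then have "collider_at M p i" "collider_at M p j"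
          using oi oj ij(3) by (auto simp: open_at_def split: if_splits)
        then have "collider_at M q i"
          using qi before after len ij by (auto simp: collider_at_def)
        then show False using False by simp
      qed
      then show ?thesis using False 3 qi by (auto simp: open_at_def)
    qed
  qed
qed

lemma open_walk_imp_open_path:
  assumes "walk M p" and "\<And>k. k < length p \<Longrightarrow> open_at M C p k" and ac: "acyclic (edges M)"
  shows "\<exists>q. path_between M (hd p) (last p) q \<and> \<not> blocked M C q"
  using assms(1,2)
proof (induction "length p" arbitrary: p rule: less_induct)
  case less
  show ?case
  proof (cases "distinct p")
    case True
    then show ?thesis
      using less.prems by (auto simp: path_between_def not_blocked_iff walk_def)
  next
    case False
    then obtain i j where ij: "i < j" "j < length p" "p ! i = p ! j"
      unfolding distinct_conv_nth by (metis linorder_neqE_nat)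
    let ?q = "take i p @ drop j p"
    note q = open_walk_shortcut[OF less.prems ij ac]
    have "hd ?q = hd p"
      using ij less.prems(1)
      by (cases "i = 0") (auto simp: hd_drop_conv_nth hd_conv_nth hd_append walk_def)
    moreover have "last ?q = last p"
      using ij by auto
    moreover have "length ?q < length p"
      using ij by auto
    ultimately show ?thesis
      using less.hyps[of ?q] q by metis
  qed
qed

section \<open>Open paths as inductive reachability, and closure properties of the connected
  set\<close>

text \<open>The flag records whether the last edge of the walk points into its end.\<close>

inductive reach :: "('n \<times> 'n) set \<Rightarrow> 'n set \<Rightarrow> 'n set \<Rightarrow> bool \<Rightarrow> 'n \<Rightarrow> bool"
  for E C A where
  start: "a \<in> A \<Longrightarrow> reach E C A False a"
| down: "reach E C A d v \<Longrightarrow> v \<notin> C \<Longrightarrow> (v, w) \<in> E \<Longrightarrow> reach E C A True w"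
| up: "reach E C A d v \<Longrightarrow> (if d then v \<in> ancestors E C else v \<notin> C) \<Longrightarrow> (w, v) \<in> E \<Longrightarrow>
    reach E C A False w"

text \<open>The endpoint must avoid \<open>C\<close>: the end of a path is never a collider, so this
  is what makes the last position open.\<close>

definition conn :: "('n \<times> 'n) set \<Rightarrow> 'n set \<Rightarrow> 'n set \<Rightarrow> 'n set" where
  "conn E C A = {v. v \<notin> C \<and> (\<exists>d. reach E C A d v)}"

text \<open>Openness is claimed only before the last position, since the continuation of the walk
  decides whether its last node is a collider. The flag keeps the one bit needed for that
  decision.\<close>

lemma reach_imp_walk:
  assumes "reach (edges M) C A d v" and "acyclic (edges M)"
    and "edges M \<subseteq> nodes M \<times> nodes M" and "A \<subseteq> nodes M"
  shows "\<exists>p. walk M p \<and> hd p \<in> A \<and> last p = v \<and>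
    (\<forall>k. Suc k < length p \<longrightarrow> open_at M C p k) \<and>
    d = (2 \<le> length p \<and> (p ! (length p - 2), v) \<in> edges M)"
  using assms(1)
proof induction
  case (start a)
  then show ?case
    using assms(4) by (intro exI[of _ "[a]"]) (auto simp: walk_def)
next
  case (down d v w)
  then obtain p where p: "walk M p" "hd p \<in> A" "last p = v"
      "\<And>k. Suc k < length p \<Longrightarrow> open_at M C p k"
      "d = (2 \<le> length p \<and> (p ! (length p - 2), v) \<in> edges M)"
    by blast
  let ?q = "p @ [w]"
  have lp: "p \<noteq> []" "p ! (length p - 1) = v" "0 < length p"
    using p by (auto simp: walk_def last_conv_nth)
  have asym: "(w, v) \<notin> edges M"
    using assms(2) down(3) unfolding acyclic_def by (meson r_into_trancl trancl_trans)
  have "walk M ?q"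
    using p(1) lp down(3) assms(3)
    by (auto simp: walk_def nth_append less_Suc_eq) (metis One_nat_def diff_Suc_1 lessI)+
  moreover have "open_at M C ?q k" if "Suc k < length ?q" for k
  proof (cases "Suc k < length p")
    case True
    then have "open_at M C ?q k = open_at M C p k"
      by (auto simp: open_at_def collider_at_def nth_append)
    then show ?thesis using p(4) True by simp
  next
    case False
    then have k: "k = length p - 1" using that by auto
    then show ?thesis using lp asym down(2)
      by (auto simp: open_at_def collider_at_def nth_append)
  qed
  ultimately show ?case
    using p lp down(3) by (intro exI[of _ ?q]) (auto simp: nth_append Suc_le_eq)
next
  case (up d v w)
  then obtain p where p: "walk M p" "hd p \<in> A" "last p = v"
      "\<And>k. Suc k < length p \<Longrightarrow> open_at M C p k"
      "d = (2 \<le> length p \<and> (p ! (length p - 2), v) \<in> edges M)"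
    by blast
  let ?q = "p @ [w]"
  have lp: "p \<noteq> []" "p ! (length p - 1) = v" "0 < length p"
    using p by (auto simp: walk_def last_conv_nth)
  have asym: "(v, w) \<notin> edges M"
    using assms(2) up(3) unfolding acyclic_def by (meson r_into_trancl trancl_trans)
  have "walk M ?q"
    using p(1) lp up(3) assms(3)
    by (auto simp: walk_def nth_append less_Suc_eq) (metis One_nat_def diff_Suc_1 lessI)+
  moreover have "open_at M C ?q k" if "Suc k < length ?q" for k
  proof (cases "Suc k < length p")
    case True
    then have "open_at M C ?q k = open_at M C p k"
      by (auto simp: open_at_def collider_at_def nth_append)
    then show ?thesis using p(4) True by simp
  next
    case False
    then have k: "k = length p - 1" using that by auto
    have "collider_at M ?q k \<longleftrightarrow> d"
      using k lp up(3) p(5) by (auto simp: collider_at_def nth_append numeral_2_eq_2)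
    then show ?thesis using k lp up(2)
      by (auto simp: open_at_def nth_append split: if_splits)
  qed
  ultimately show ?case
    using p lp asym up(3) by (intro exI[of _ ?q]) (auto simp: nth_append Suc_le_eq)
qed

text \<open>The walk obtained from reachability is open at its end too, which avoids
  \<open>C\<close>; cutting out loops turns it into an open path.\<close>

lemma conn_disjoint_if_d_separated:
  assumes "d_separated M A B C" and ac: "acyclic (edges M)"
    and "edges M \<subseteq> nodes M \<times> nodes M" and "A \<subseteq> nodes M"
  shows "conn (edges M) C A \<inter> B = {}"
proof (rule ccontr)
  assume "\<not> ?thesis"
  then obtain v d where v: "v \<in> B" "v \<notin> C" "reach (edges M) C A d v"
    by (auto simp: conn_def)
  then obtain p where p: "walk M p" "hd p \<in> A" "last p = v"
      "\<And>k. Suc k < length p \<Longrightarrow> open_at M C p k"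
    using reach_imp_walk[OF v(3) assms(2-4)] by blast
  have "open_at M C p k" if "k < length p" for k
  proof (cases "Suc k < length p")
    case False
    then have "k = length p - 1" using that by auto
    then have "p ! k = v" using p by (auto simp: walk_def last_conv_nth)
    then show ?thesis using False v by (auto simp: open_at_def collider_at_def)
  qed (use p in auto)
  then obtain q where "path_between M (hd p) v q" "\<not> blocked M C q"
    using open_walk_imp_open_path[OF p(1) _ ac] p(3) by metis
  then show False
    using assms(1) p(2) v(1) unfolding d_separated_def by blast
qed

lemma collider_at_rev:
  assumes "i < length p"
  shows "collider_at M (rev p) i \<longleftrightarrow> collider_at M p (length p - Suc i)"
proof -
  have "Suc i < length p \<Longrightarrow> length p - Suc (Suc i) = length p - Suc i - 1"
    "0 < i \<Longrightarrow> length p - Suc (i - 1) = Suc (length p - Suc i)"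
    using assms by auto
  then show ?thesis
    using assms by (auto simp: collider_at_def rev_nth)
qed

text \<open>Reversing a path only exchanges the two neighbours of each node, so colliders and
  blocking are preserved.\<close>

lemma d_separated_sym: "d_separated M A B C \<Longrightarrow> d_separated M B A C"
  unfolding d_separated_def
proof (intro ballI allI impI)
  fix a b p
  assume sep: "\<forall>a\<in>A. \<forall>b\<in>B. \<forall>p. path_between M a b p \<longrightarrow> blocked M C p"
    and ab: "a \<in> A" "b \<in> B" and p: "path_between M b a p"
  have "(rev p ! i, rev p ! Suc i) \<in> edges M \<or> (rev p ! Suc i, rev p ! i) \<in> edges M"
    if i: "Suc i < length p" for i
  proof -
    define k where "k = length p - Suc (Suc i)"
    have "rev p ! i = p ! Suc k" "rev p ! Suc i = p ! k" "Suc k < length p"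
      using i by (auto simp: k_def rev_nth Suc_diff_Suc)
    then show ?thesis
      using p unfolding path_between_def by auto
  qed
  then have "path_between M a b (rev p)"
    using p unfolding path_between_def by (auto simp: hd_rev last_rev)
  then have "blocked M C (rev p)"
    using sep ab by blast
  then obtain i where i: "i < length p" "\<not> open_at M C (rev p) i"
    using not_blocked_iff[of M C "rev p"] by auto
  then have "\<not> open_at M C p (length p - Suc i)"
    by (auto simp: open_at_def collider_at_rev rev_nth split: if_splits)
  moreover have "length p - Suc i < length p"
    using i by simp
  ultimately show "blocked M C p"
    using not_blocked_iff[of M C p] by blast
qed

text \<open>A directed path from \<open>v\<close> to \<open>A\<close> can be climbed from its end: a
  node of it in \<open>C\<close> would make \<open>v\<close> an ancestor of
  \<open>C\<close>.\<close>

lemma reach_ancestors_source: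
  assumes "v \<in> ancestors E A" and "v \<notin> ancestors E C"
  shows "reach E C A False v"
proof -
  obtain a where a: "a \<in> A" "(v, a) \<in> E\<^sup>*" using assms(1) by (auto simp: ancestors_def)
  from a(2) assms(2) show ?thesis
  proof (induction rule: converse_rtrancl_induct)
    case base
    show ?case using a(1) by (rule reach.start)
  next
    case (step v w)
    then have "w \<notin> ancestors E C" using ancestors_step[of v w E C] by blast
    then have "w \<notin> C" and "reach E C A False w"
      using subset_ancestors[of C E] step.IH by auto
    then show ?case using step.hyps(1) reach.up[of E C A False w v] by simp
  qed
qed

lemma conn_descend:
  assumes "v \<in> conn E C A" and "(v, w) \<in> E\<^sup>*" and "v \<notin> ancestors E C"
  shows "w \<in> conn E C A"
  using assms(2,1,3)
proof (induction rule: converse_rtrancl_induct)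
  case (step v v')
  then have "v' \<notin> ancestors E C"
    using ancestors_step[of v v' E C] by blast
  moreover from this have "v' \<in> conn E C A"
    using step subset_ancestors[of C E] unfolding conn_def by (auto intro: reach.down)
  ultimately show ?case using step by blast
qed

text \<open>The scope of the mechanism of \<open>v\<close>: all variables, observed or not, on which
  this factor depends.\<close>

definition family :: "('n \<times> 'n) set \<Rightarrow> 'n \<Rightarrow> 'n set" where
  "family E v = insert v {w. (w, v) \<in> E}"

text \<open>Plays the part of moralization: members of one family are linked through
  \<open>v\<close>. If \<open>v\<close> is an ancestor of \<open>C\<close>, the walk may turn at
  \<open>v\<close>; otherwise \<open>v\<close> is an ancestor of \<open>A\<close>, is reached from
  \<open>A\<close> by climbing, and the climb continues to every parent.\<close>

lemma conn_family:
  assumes "w \<in> conn E C A" and "w \<in> family E v" and "w' \<in> family E v" and "w' \<notin> C"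
    and "v \<in> ancestors E (A \<union> C)"
  shows "w' \<in> conn E C A"
proof -
  obtain d where d: "reach E C A d w" "w \<notin> C" using assms(1) by (auto simp: conn_def)
  have v: "\<exists>d. reach E C A d v \<and> (d \<or> v \<notin> C)"
    using assms(2) d reach.down[OF d] by (auto simp: family_def)
  show ?thesis
  proof (cases "w' = v")
    case True
    then show ?thesis using v assms(4) by (auto simp: conn_def)
  next
    case False
    then have e: "(w', v) \<in> E" using assms(3) by (auto simp: family_def)
    have "reach E C A False w'"
    proof (cases "v \<in> ancestors E C")
      case True
      then show ?thesis using v e reach.up[of E C A _ v w'] by (metis (full_types))
    next
      case False
      then have "reach E C A False v" "v \<notin> C"
        using assms(5) reach_ancestors_source[of v E A C] subset_ancestors[of C E]
        by (auto simp: ancestors_Un)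
      then show ?thesis using e reach.up[of E C A False v w'] by simp
    qed
    then show ?thesis using assms(4) by (auto simp: conn_def)
  qed
qed

text \<open>Covers factors outside the ancestors of \<open>C\<close>: nothing below \<open>v\<close>
  can block, so the connection runs down to every descendant. It serves to contradict a
  separation.\<close>

lemma conn_family_descend:
  assumes "w \<in> conn E C A" and "w \<in> family E v" and "(v, y) \<in> E\<^sup>*" and "v \<notin> ancestors E C"
  shows "y \<in> conn E C A"
proof -
  have "v \<notin> C" using assms(4) subset_ancestors[of C E] by blast
  then have "v \<in> conn E C A"
    using assms(1,2) by (auto simp: family_def conn_def intro: reach.down)
  then show ?thesis using conn_descend[of v E C A y] assms by blast
qed

section \<open>Sums over assignments\<close>

text \<open>Values in \<open>ennreal\<close> keep Fubini free of summability conditions. Assignments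
  are total functions of which only the coordinates in \<open>X\<close> are overwritten, so that
  sums over different sets nest.\<close>

definition msum :: "'n set \<Rightarrow> (('n \<Rightarrow> 'b) \<Rightarrow> ennreal) \<Rightarrow> ('n \<Rightarrow> 'b) \<Rightarrow> ennreal" where
  "msum X f a = (\<integral>\<^sup>+x. f (override_on a x X) \<partial>count_space (PiE X (\<lambda>_. UNIV)))"

definition depends_only_on :: "'n set \<Rightarrow> (('n \<Rightarrow> 'b) \<Rightarrow> 'd) \<Rightarrow> bool" where
  "depends_only_on K f \<longleftrightarrow> (\<forall>x x'. (\<forall>v\<in>K. x v = x' v) \<longrightarrow> f x = f x')"

lemma depends_only_onD: "depends_only_on K f \<Longrightarrow> (\<And>v. v \<in> K \<Longrightarrow> x v = x' v) \<Longrightarrow> f x = f x'"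
  unfolding depends_only_on_def by blast

lemma msum_empty [simp]: "msum {} f a = f a"
  by (simp add: msum_def nn_integral_count_space_finite)

text \<open>Fubini for one coordinate; countability of the value type makes the counting measures
  sigma-finite.\<close>

lemma msum_insert:
  fixes f :: "('n \<Rightarrow> 'b::countable) \<Rightarrow> ennreal"
  assumes "finite X" "v \<notin> X"
  shows "msum (insert v X) f a = (\<integral>\<^sup>+c. msum X f (a(v := c)) \<partial>count_space UNIV)"
proof -
  let ?P = "\<lambda>X. PiE X (\<lambda>_. UNIV :: 'b set)"
  have bij: "bij_betw (\<lambda>(c, g). g(v := c)) (UNIV \<times> ?P X) (?P (insert v X))"
    unfolding bij_betw_def PiE_insert_eq using inj_combinator[OF assms(2), of "\<lambda>_. UNIV"] by simp
  have cnt: "countable (?P X)"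
    using assms(1) by (intro countable_PiE) auto
  interpret sigma_finite_measure "count_space (?P X)"
    using cnt by (rule sigma_finite_measure_count_space_countable)
  have "msum (insert v X) f a =
      (\<integral>\<^sup>+p. f (override_on a ((\<lambda>(c, g). g(v := c)) p) (insert v X)) \<partial>count_space (UNIV \<times> ?P X))"
    unfolding msum_def by (rule nn_integral_bij_count_space[OF bij, symmetric])
  also have "\<dots> = (\<integral>\<^sup>+p. f (override_on (a(v := fst p)) (snd p) X) \<partial>count_space (UNIV \<times> ?P X))"
    using assms(2)
    by (intro nn_integral_cong arg_cong[of _ _ f]) (auto simp: override_on_def fun_eq_iff)
  also have "\<dots> = (\<integral>\<^sup>+p. f (override_on (a(v := fst p)) (snd p) X)
      \<partial>(count_space UNIV \<Otimes>\<^sub>M count_space (?P X)))"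
    by (simp add: pair_measure_countable cnt)
  also have "\<dots> = (\<integral>\<^sup>+c. \<integral>\<^sup>+g. f (override_on (a(v := c)) g X) \<partial>count_space (?P X) \<partial>count_space UNIV)"
    by (subst nn_integral_fst[symmetric]) (auto simp: pair_measure_countable cnt)
  finally show ?thesis
    by (simp add: msum_def)
qed

lemma msum_Un:
  fixes f :: "('n \<Rightarrow> 'b::countable) \<Rightarrow> ennreal"
  assumes "finite X" "finite Y" "X \<inter> Y = {}"
  shows "msum (X \<union> Y) f a = msum X (msum Y f) a"
  using assms(1,3)
proof (induction X arbitrary: a rule: finite_induct)
  case (insert v X)
  then show ?case
    using assms(2) by (simp add: msum_insert)
qed simp

lemma msum_cong: "(\<And>x. (\<And>v. v \<notin> X \<Longrightarrow> x v = a v) \<Longrightarrow> f x = g x) \<Longrightarrow> msum X f a = msum X g a"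
  unfolding msum_def by (rule nn_integral_cong) (simp add: override_on_def)

lemma msum_mult_left:
  assumes "depends_only_on K f" "K \<inter> X = {}"
  shows "msum X (\<lambda>x. f x * g x) a = f a * msum X g a"
proof -
  have "f (override_on a x X) = f a" for x
    using assms(2) by (intro depends_only_onD[OF assms(1)]) (auto simp: override_on_def)
  then show ?thesis
    by (simp add: msum_def nn_integral_cmult)
qed

lemma depends_msum:
  assumes "depends_only_on K f"
  shows "depends_only_on (K - X) (msum X f)"
  unfolding depends_only_on_def
proof (intro allI impI)
  fix a a' :: "'a \<Rightarrow> 'b"
  assume "\<forall>v\<in>K - X. a v = a' v"
  then have "f (override_on a x X) = f (override_on a' x X)" for x
    by (intro depends_only_onD[OF assms]) (auto simp: override_on_def)
  then show "msum X f a = msum X f a'"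
    by (simp add: msum_def)
qed

text \<open>Distributivity: each factor is constant in the coordinates over which the other one is
  summed.\<close>

lemma msum_prod:
  fixes f g :: "('n \<Rightarrow> 'b::countable) \<Rightarrow> ennreal"
  assumes "finite X" "finite Y" "X \<inter> Y = {}"
    and f: "depends_only_on K f" "K \<inter> Y = {}" and g: "depends_only_on L g" "L \<inter> X = {}"
  shows "msum (X \<union> Y) (\<lambda>x. f x * g x) a = msum X f a * msum Y g a"
proof -
  have "msum Y (\<lambda>x. f x * g x) = (\<lambda>x. f x * msum Y g x)"
    using msum_mult_left[OF f] by blast
  then have "msum (X \<union> Y) (\<lambda>x. f x * g x) a = msum X (\<lambda>x. f x * msum Y g x) a"
    by (simp add: msum_Un assms(1-3))
  also have "\<dots> = msum X (\<lambda>x. msum Y g x * f x) a"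
    by (simp add: mult.commute)
  also have "\<dots> = msum Y g a * msum X f a"
    by (rule msum_mult_left[OF depends_msum[OF g(1)]]) (use g(2) in auto)
  finally show ?thesis
    by (simp add: mult.commute)
qed

lemma msum_ge:
  fixes f :: "('n \<Rightarrow> 'b::countable) \<Rightarrow> ennreal"
  shows "f a \<le> msum X f a"
proof -
  have "f a = f (override_on a (restrict a X) X)"
    by (rule arg_cong[of _ _ f]) (auto simp: override_on_def)
  also have "\<dots> \<le> msum X f a"
    unfolding msum_def
    by (rule nn_integral_ge_point) auto
  finally show ?thesis .
qed

section \<open>Sums with fixed coordinates, and real infinite sums\<close>

lemma nn_integral_agreeing:
  assumes "A \<subseteq> V"
  shows "(\<integral>\<^sup>+x. f x * indicator {x. \<forall>v\<in>A. x v = a v} x \<partial>count_space (PiE V (\<lambda>_. UNIV))) =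
    (\<integral>\<^sup>+x. f (restrict (override_on a x (V - A)) V) \<partial>count_space (PiE (V - A) (\<lambda>_. UNIV)))"
proof -
  let ?S = "{x \<in> PiE V (\<lambda>_. UNIV). \<forall>v\<in>A. x v = a v}"
  have "bij_betw (\<lambda>x. restrict (override_on a x (V - A)) V) (PiE (V - A) (\<lambda>_. UNIV)) ?S"
  proof (rule bij_betwI[where g = "\<lambda>x. restrict x (V - A)"])
    show "(\<lambda>x. restrict (override_on a x (V - A)) V) \<in> PiE (V - A) (\<lambda>_. UNIV) \<rightarrow> ?S"
      using assms by (auto simp: override_on_def)
  qed (use assms in \<open>auto simp: override_on_def fun_eq_iff PiE_def extensional_def\<close>)
  from nn_integral_bij_count_space[OF this, of f]
  have "(\<integral>\<^sup>+x. f (restrict (override_on a x (V - A)) V) \<partial>count_space (PiE (V - A) (\<lambda>_. UNIV))) =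
      (\<integral>\<^sup>+x. f x \<partial>count_space ?S)" .
  also have "\<dots> = (\<integral>\<^sup>+x. f x * indicator {x. \<forall>v\<in>A. x v = a v} x \<partial>count_space (PiE V (\<lambda>_. UNIV)))"
    by (auto simp: nn_integral_count_space_indicator indicator_def intro!: nn_integral_cong)
  finally show ?thesis by simp
qed

lemma nn_integral_agreeing_msum:
  assumes "A \<subseteq> V" and "depends_only_on V f"
  shows "(\<integral>\<^sup>+x. f x * indicator {x. \<forall>v\<in>A. x v = a v} x \<partial>count_space (PiE V (\<lambda>_. UNIV))) =
    msum (V - A) f a"
  unfolding nn_integral_agreeing[OF assms(1)] msum_def
  by (intro nn_integral_cong depends_only_onD[OF assms(2)]) simp

text \<open>No summability is assumed: a divergent sum is \<open>0\<close> on both sides, by the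
  default of \<open>infsum\<close> and by \<open>enn2real\<close> of infinity.\<close>

lemma infsum_nonneg_eq_nn_integral:
  fixes f :: "'a \<Rightarrow> real"
  assumes "\<And>x. x \<in> A \<Longrightarrow> 0 \<le> f x"
  shows "infsum f A = enn2real (\<integral>\<^sup>+x. ennreal (f x) \<partial>count_space A)"
proof (cases "integrable (count_space A) f")
  case True
  then have "infsum f A = infsetsum f A"
    using infsetsum_infsum[of f A] by (simp add: abs_summable_on_def)
  also have "\<dots> = enn2real (\<integral>\<^sup>+x. ennreal (f x) \<partial>count_space A)"
    unfolding infsetsum_def by (rule integral_eq_nn_integral) (auto simp: AE_count_space assms)
  finally show ?thesis .
next
  case False
  then have "\<not> (\<lambda>x. norm (f x)) summable_on A"
    using abs_summable_equivalent[of f A] by (simp add: abs_summable_on_def)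
  moreover have "f summable_on A \<longleftrightarrow> (\<lambda>x. norm (f x)) summable_on A"
    using assms by (intro summable_on_cong) auto
  ultimately have "infsum f A = 0"
    by (simp add: infsum_not_exists)
  moreover have "(\<integral>\<^sup>+x. ennreal (f x) \<partial>count_space A) = \<infinity>"
  proof (rule ccontr)
    assume "\<not> ?thesis"
    then have "integrable (count_space A) f"
      by (intro integrableI_nonneg) (auto simp: AE_count_space assms top.not_eq_extremum)
    then show False
      using False by simp
  qed
  ultimately show ?thesis by simp
qed

lemma msum_singleton:
  fixes f :: "('n \<Rightarrow> 'b::countable) \<Rightarrow> ennreal"
  shows "msum {v} f a = (\<integral>\<^sup>+c. f (a(v := c)) \<partial>count_space UNIV)"
  using msum_insert[of "{}" v f a] by simp

lemma msum_Un3: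
  fixes f :: "('n \<Rightarrow> 'b::countable) \<Rightarrow> ennreal"
  assumes "finite X" "finite Y" "finite Z" "X \<inter> (Y \<union> Z) = {}" "Y \<inter> Z = {}"
  shows "msum (X \<union> (Y \<union> Z)) f a = msum X (msum Y (msum Z f)) a"
proof -
  have "msum (Y \<union> Z) f = msum Y (msum Z f)"
    using assms by (intro ext msum_Un)
  then show ?thesis
    using msum_Un[of X "Y \<union> Z" f a] assms by simp
qed

lemma msum_fun_upd:
  assumes "v \<notin> X"
  shows "msum X (\<lambda>x. f (x(v := c))) a = msum X f (a(v := c))"
proof -
  have "(override_on a x X)(v := c) = override_on (a(v := c)) x X" for x
    using assms by (auto simp: override_on_def fun_eq_iff)
  then show ?thesis
    by (simp add: msum_def)
qed

section \<open>The global Markov property\<close>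

lemma depends_mono: "depends_only_on K f \<Longrightarrow> K \<subseteq> L \<Longrightarrow> depends_only_on L f"
  unfolding depends_only_on_def by blast

locale markovian_model =
  fixes M :: "('n, 'b :: countable, 'c) smcm"
  assumes semi_markovian: "semi_markovian M"
begin

lemma
  shows finite_observed: "finite (observed M)"
    and finite_nodes: "finite (nodes M)"
    and edges_nodes: "edges M \<subseteq> nodes M \<times> nodes M"
    and acyclic_edges: "acyclic (edges M)"
    and disjoint_observed: "observed M \<inter> unobserved M = {}"
    and no_latent_target: "u \<in> unobserved M \<Longrightarrow> (w, u) \<notin> edges M"
  using semi_markovian by (auto simp: semi_markovian_def nodes_def)

sublocale prob_space "latent_law M"
  using semi_markovian by (auto simp: semi_markovian_def)

section \<open>Expected products of mechanisms and their marginals\<close>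

lemma indep_latent: "indep_vars (latent_space M) (\<lambda>w u. u w) (unobserved M)"
  using semi_markovian by (auto simp: semi_markovian_def)

lemma sets_latent_law: "sets (latent_law M) = sets (PiM (unobserved M) (latent_space M))"
  using semi_markovian by (auto simp: semi_markovian_def)

lemma edge_irrefl: "(v, v) \<notin> edges M"
  using acyclic_edges by (auto simp: acyclic_def)

text \<open>The quantity written \<open>Q[D]\<close> by Tian and Pearl: the law of \<open>D\<close>
  when all other observed variables are held fixed by intervention.\<close>

definition fac :: "'n set \<Rightarrow> ('n \<Rightarrow> 'b) \<Rightarrow> ennreal" where
  "fac D x = (\<integral>\<^sup>+u. (\<Prod>v\<in>D. ennreal (mechanism M v x u)) \<partial>latent_law M)"

lemma measurable_kernel:
  "v \<in> observed M \<Longrightarrow> (\<lambda>w. pmf (kernel M v (restrict x (obs_parents M v)) w) c)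
    \<in> borel_measurable (PiM (unobs_parents M v) (latent_space M))"
  using semi_markovian unfolding semi_markovian_def by (auto simp: restrict_PiE)

lemma measurable_mechanism_PiM:
  assumes "v \<in> observed M" "unobs_parents M v \<subseteq> U"
  shows "mechanism M v x \<in> borel_measurable (PiM U (latent_space M))"
  unfolding mechanism_def
  by (rule measurable_compose[OF measurable_restrict_subset[OF assms(2)] measurable_kernel[OF assms(1)]])

lemma measurable_mechanism:
  assumes "v \<in> observed M"
  shows "mechanism M v x \<in> borel_measurable (latent_law M)"
  using measurable_mechanism_PiM[OF assms, of "unobserved M" x]
  by (simp add: measurable_cong_sets[OF sets_latent_law refl] unobs_parents_def)

lemma mechanism_cong:
  "(\<And>w. w \<in> insert v (obs_parents M v) \<Longrightarrow> x w = x' w) \<Longrightarrow> mechanism M v x u = mechanism M v x' u"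
  unfolding mechanism_def by (auto cong: restrict_cong)

lemma depends_fac: "depends_only_on (\<Union>v\<in>D. insert v (obs_parents M v)) (fac D)"
  unfolding depends_only_on_def fac_def
  by (intro allI impI nn_integral_cong prod.cong refl arg_cong[of _ _ ennreal] mechanism_cong) blast

lemma fac_empty [simp]: "fac {} x = 1"
  by (simp add: fac_def emeasure_space_1)

text \<open>The two products read disjoint blocks of the independent unobserved variables, so the
  expectation of their product factorises.\<close>

lemma fac_Un_indep:
  assumes D: "D1 \<subseteq> observed M" "D2 \<subseteq> observed M" "D1 \<inter> D2 = {}"
    and U: "(\<Union>v\<in>D1. unobs_parents M v) \<inter> (\<Union>v\<in>D2. unobs_parents M v) = {}"
  shows "fac (D1 \<union> D2) x = fac D1 x * fac D2 x"
proof -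
  define Ds where "Ds = (\<lambda>b. if b then D1 else D2)"
  define Us where "Us b = (\<Union>v\<in>Ds b. unobs_parents M v)" for b
  define Y where "Y b w = (\<Prod>v\<in>Ds b. ennreal (mechanism M v x w))" for b w
  have fin: "finite D1" "finite D2"
    using D finite_observed by (auto intro: finite_subset)
  have "indep_vars (\<lambda>b. PiM (Us b) (latent_space M)) (\<lambda>b u. restrict (\<lambda>w. u w) (Us b)) UNIV"
    using U by (intro indep_vars_restrict[OF indep_latent])
      (auto simp: Us_def Ds_def unobs_parents_def disjoint_family_on_def split: if_splits)
  moreover have "Y b \<in> borel_measurable (PiM (Us b) (latent_space M))" for b
  proof -
    have "mechanism M v x \<in> borel_measurable (PiM (Us b) (latent_space M))" if "v \<in> Ds b" for v
      using that D by (intro measurable_mechanism_PiM) (auto simp: Us_def Ds_def split: if_splits)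
    then have "(\<lambda>w. \<Prod>v\<in>Ds b. ennreal (mechanism M v x w)) \<in> borel_measurable (PiM (Us b) (latent_space M))"
      by (intro borel_measurable_prod_ennreal measurable_compose[OF _ measurable_ennreal]) auto
    then show ?thesis
      by (simp add: Y_def[abs_def])
  qed
  ultimately have "indep_vars (\<lambda>_. borel) (\<lambda>b u. Y b (restrict (\<lambda>w. u w) (Us b))) UNIV"
    by (rule indep_vars_compose2)
  moreover have "Y b (restrict u (Us b)) = Y b u" for b u
  proof -
    have "restrict (restrict u (Us b)) (unobs_parents M v) = restrict u (unobs_parents M v)"
      if "v \<in> Ds b" for v
      using that by (auto simp: Us_def restrict_def fun_eq_iff)
    then show ?thesis
      by (simp add: Y_def mechanism_def)
  qed
  ultimately have "indep_vars (\<lambda>_. borel) Y UNIV"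
    by simp
  then have "(\<integral>\<^sup>+u. (\<Prod>b\<in>UNIV. Y b u) \<partial>latent_law M) = (\<Prod>b\<in>UNIV. \<integral>\<^sup>+u. Y b u \<partial>latent_law M)"
    by (intro indep_vars_nn_integral) auto
  then show ?thesis
    by (simp add: UNIV_bool Y_def Ds_def fac_def prod.union_disjoint[OF fin D(3)] mult.commute)
qed

text \<open>Only observed parents are required: unobserved variables are roots and are integrated
  out in \<open>fac\<close>.\<close>

definition ancestral :: "'n set \<Rightarrow> bool" where
  "ancestral D \<longleftrightarrow> D \<subseteq> observed M \<and> (\<forall>v\<in>D. obs_parents M v \<subseteq> D)"

text \<open>No mechanism in \<open>D\<close> reads \<open>v\<close>, and the kernel of
  \<open>v\<close> sums to \<open>1\<close> for each value of its parents.\<close>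

lemma fac_sink:
  assumes D: "ancestral D" and v: "v \<in> observed M" "v \<notin> D"
  shows "(\<integral>\<^sup>+c. fac (insert v D) (x(v := c)) \<partial>count_space UNIV) = fac D x"
proof -
  have fin: "finite D"
    using D finite_observed by (auto simp: ancestral_def intro: finite_subset)
  have meas: "w \<in> insert v D \<Longrightarrow> mechanism M w x \<in> borel_measurable (latent_law M)" for w x
    using D v measurable_mechanism by (auto simp: ancestral_def)
  have cong: "w \<in> D \<Longrightarrow> mechanism M w (x(v := c)) u = mechanism M w x u" for w c u
    using D v by (intro mechanism_cong) (auto simp: ancestral_def)
  have v0: "v \<notin> obs_parents M v"
    using edge_irrefl by (auto simp: obs_parents_def)
  have "(\<integral>\<^sup>+c. fac (insert v D) (x(v := c)) \<partial>count_space UNIV) =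
      (\<integral>\<^sup>+u. \<integral>\<^sup>+c. (\<Prod>w\<in>insert v D. ennreal (mechanism M w (x(v := c)) u)) \<partial>count_space UNIV \<partial>latent_law M)"
    unfolding fac_def using meas
    by (intro nn_integral_count_space_nn_integral[symmetric] borel_measurable_prod_ennreal) auto
  also have "\<dots> = (\<integral>\<^sup>+u. \<integral>\<^sup>+c. (\<Prod>w\<in>D. ennreal (mechanism M w x u)) * ennreal (mechanism M v (x(v := c)) u)
      \<partial>count_space UNIV \<partial>latent_law M)"
    using fin v(2) cong by (simp add: mult.commute)
  also have "\<dots> = (\<integral>\<^sup>+u. (\<Prod>w\<in>D. ennreal (mechanism M w x u)) * 1 \<partial>latent_law M)"
  proof (intro nn_integral_cong)
    fix u
    let ?k = "kernel M v (restrict x (obs_parents M v)) (restrict u (unobs_parents M v))"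
    have "mechanism M v (x(v := c)) u = pmf ?k c" for c
      using v0 by (simp add: mechanism_def restrict_fupd)
    then have "(\<integral>\<^sup>+c. ennreal (mechanism M v (x(v := c)) u) \<partial>count_space UNIV) = 1"
      by (simp add: nn_integral_pmf measure_pmf.emeasure_space_1[simplified])
    then show "(\<integral>\<^sup>+c. (\<Prod>w\<in>D. ennreal (mechanism M w x u)) * ennreal (mechanism M v (x(v := c)) u)
      \<partial>count_space UNIV) = (\<Prod>w\<in>D. ennreal (mechanism M w x u)) * 1"
      by (simp add: nn_integral_cmult)
  qed
  finally show ?thesis
    by (simp add: fac_def)
qed

lemma ex_source:
  assumes "ancestral D" "ancestral D'" "D \<subset> D'"
  shows "\<exists>v\<in>D' - D. ancestral (insert v D)"
proof -
  have "finite (edges M)"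
    using edges_nodes finite_nodes by (meson finite_SigmaI finite_subset)
  then have "wf (edges M)"
    using acyclic_edges by (rule finite_acyclic_wf)
  then obtain v where v: "v \<in> D' - D" "\<And>w. (w, v) \<in> edges M \<Longrightarrow> w \<notin> D' - D"
    using assms(3) by (metis Diff_eq_empty_iff all_not_in_conv psubset_eq subset_antisym wfE_min)
  then have "ancestral (insert v D)"
    using assms unfolding ancestral_def obs_parents_def by blast
  then show ?thesis
    using v(1) by blast
qed

text \<open>Barren nodes sum to \<open>1\<close>. The set \<open>D\<close> grows by a source of the
  remainder; the induction hypothesis sums over the rest, and \<open>fac_sink\<close> removes the
  added node.\<close>

lemma fac_marginal:
  assumes "ancestral D" "ancestral D'" "D \<subseteq> D'"
  shows "msum (D' - D) (fac D') a = fac D a"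
  using assms(1,3)
proof (induction "card (D' - D)" arbitrary: D a rule: less_induct)
  case less
  have fin: "finite D'"
    using assms(2) finite_observed by (auto simp: ancestral_def intro: finite_subset)
  show ?case
  proof (cases "D = D'")
    case False
    then obtain v where v: "v \<in> D' - D" "ancestral (insert v D)"
      using ex_source[of D D'] less.prems assms(2) by blast
    have eq: "D' - D = insert v (D' - insert v D)"
      using v(1) by auto
    have "card (D' - insert v D) < card (D' - D)"
      using v(1) fin by (intro psubset_card_mono) auto
    then have IH: "msum (D' - insert v D) (fac D') a = fac (insert v D) a" for a
      using less.hyps v less.prems by auto
    have "msum (D' - D) (fac D') a = (\<integral>\<^sup>+c. fac (insert v D) (a(v := c)) \<partial>count_space UNIV)"
      using fin by (subst eq, subst msum_insert) (auto simp: IH)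
    also have "\<dots> = fac D a"
      using v assms(2) less.prems(1) by (intro fac_sink) (auto simp: ancestral_def)
    finally show ?thesis .
  qed simp
qed

section \<open>Marginals of the observational law\<close>

lemma mechanism_nonneg [simp]: "0 \<le> mechanism M v x u"
  by (simp add: mechanism_def)

lemma fac_observed: "fac (observed M) x = ennreal (obs_prob M x)"
proof -
  have "(\<Prod>v\<in>observed M. mechanism M v x u) \<le> 1" for u
    by (intro prod_le_1) (auto simp: mechanism_def pmf_le_1)
  then have "integrable (latent_law M) (\<lambda>u. \<Prod>v\<in>observed M. mechanism M v x u)"
    by (intro integrable_const_bound[of _ 1] AE_I2 borel_measurable_prod measurable_mechanism)
      (auto simp: prod_nonneg)
  then show ?thesis
    unfolding fac_def obs_prob_def
    by (subst nn_integral_eq_integral[symmetric]) (auto simp: prod_nonneg prod_ennreal)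
qed

text \<open>The argument is a total assignment, so that marginals over different sets can be
  multiplied and summed at one common argument.\<close>

definition pr :: "'n set \<Rightarrow> ('n \<Rightarrow> 'b) \<Rightarrow> ennreal" where
  "pr A = msum (observed M - A) (fac (observed M))"

lemma ancestral_observed: "ancestral (observed M)"
  by (auto simp: ancestral_def obs_parents_def)

lemma ancestral_empty: "ancestral {}"
  by (simp add: ancestral_def)

lemma depends_fac_observed: "depends_only_on (observed M) (fac (observed M))"
  by (rule depends_mono[OF depends_fac]) (auto simp: obs_parents_def)

lemma depends_pr: "depends_only_on A (pr A)"
  unfolding pr_def by (rule depends_mono[OF depends_msum[OF depends_fac_observed]]) auto

lemma pr_sum:
  assumes "A \<union> X \<subseteq> observed M" "A \<inter> X = {}"
  shows "msum X (pr (A \<union> X)) a = pr A a"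
proof -
  have fin: "finite X" "finite (observed M - (A \<union> X))"
    using assms finite_observed by (auto intro: finite_subset)
  have eq: "observed M - A = X \<union> (observed M - (A \<union> X))"
    using assms by auto
  show ?thesis
    unfolding pr_def by (subst eq, rule msum_Un[OF fin, symmetric]) auto
qed

lemma pr_empty [simp]: "pr {} a = 1"
  using fac_marginal[OF ancestral_empty ancestral_observed] by (simp add: pr_def)

lemma pr_mono:
  assumes "A \<subseteq> B" "B \<subseteq> observed M"
  shows "pr B a \<le> pr A a"
proof -
  have "A \<union> (B - A) = B" using assms by auto
  then show ?thesis
    using msum_ge[of "pr B" a "B - A"] pr_sum[of A "B - A" a] assms by auto
qed

lemma pr_le_1: "A \<subseteq> observed M \<Longrightarrow> pr A a \<le> 1"
  using pr_mono[of "{}" A a] by simp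

lemma emeasure_obs_law:
  assumes "A \<subseteq> observed M"
  shows "emeasure (obs_law M) {x \<in> space (obs_law M). agrees A a x} = pr A a"
proof -
  have "emeasure (obs_law M) {x \<in> space (obs_law M). agrees A a x} =
      (\<integral>\<^sup>+x. fac (observed M) x * indicator {x. \<forall>v\<in>A. x v = a v} x
        \<partial>count_space (PiE (observed M) (\<lambda>_. UNIV)))"
    unfolding obs_law_def
    by (subst emeasure_density) (auto simp: fac_observed indicator_def intro!: nn_integral_cong)
  also have "\<dots> = pr A a"
    unfolding pr_def by (rule nn_integral_agreeing_msum[OF assms depends_fac_observed])
  finally show ?thesis .
qed

lemma measure_obs_law:
  "A \<subseteq> observed M \<Longrightarrow> \<P>(x in obs_law M. agrees A a x) = enn2real (pr A a)"
  by (simp add: measure_def emeasure_obs_law)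

section \<open>From factorization to conditional independence\<close>

lemma pr_ancestral:
  assumes D: "ancestral D" and A: "A \<subseteq> D"
  shows "pr A a = msum (D - A) (fac D) a"
proof -
  have obs: "D \<subseteq> observed M" using D by (simp add: ancestral_def)
  have fin: "finite D" "finite (observed M - D)"
    using obs finite_observed by (auto intro: finite_subset)
  have "observed M - A = (D - A) \<union> (observed M - D)"
    using A obs by auto
  then have "pr A a = msum (D - A) (msum (observed M - D) (fac (observed M))) a"
    unfolding pr_def using fin by (subst msum_Un[symmetric]) auto
  also have "msum (observed M - D) (fac (observed M)) = fac D"
    using fac_marginal[OF D ancestral_observed obs] by blast
  finally show ?thesis .
qed

text \<open>The two groups of factors share only variables of \<open>A\<close>, which are not
  summed. They share no unobserved variable, because \<open>A\<close> contains none, so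
  \<open>fac_Un_indep\<close> splits the expectation and \<open>msum_prod\<close> the sum.\<close>

lemma pr_factorization:
  assumes D: "ancestral D" and D1: "D1 \<subseteq> D" and A: "A \<subseteq> D"
    and sep: "(\<Union>v\<in>D1. family (edges M) v) \<inter> (\<Union>v\<in>D - D1. family (edges M) v) \<subseteq> A"
  shows "pr A a = msum (D \<inter> (\<Union>v\<in>D1. family (edges M) v) - A) (fac D1) a *
    msum (D - (\<Union>v\<in>D1. family (edges M) v) - A) (fac (D - D1)) a"
proof -
  let ?F = "\<lambda>D. \<Union>v\<in>D. family (edges M) v"
  have obs: "D \<subseteq> observed M" using D by (simp add: ancestral_def)
  have fin: "finite D"
    using obs finite_observed by (rule finite_subset)
  have sub: "D1 \<subseteq> observed M" "D - D1 \<subseteq> observed M" "D1 \<inter> (D - D1) = {}"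
    using obs D1 by auto
  have fam: "(\<Union>v\<in>E. insert v (obs_parents M v)) \<subseteq> ?F E" "(\<Union>v\<in>E. unobs_parents M v) \<subseteq> ?F E"
    for E by (auto simp: family_def obs_parents_def unobs_parents_def)
  have lat: "(\<Union>v\<in>D1. unobs_parents M v) \<inter> (\<Union>v\<in>D - D1. unobs_parents M v) = {}"
  proof (rule equals0I)
    fix u
    assume u: "u \<in> (\<Union>v\<in>D1. unobs_parents M v) \<inter> (\<Union>v\<in>D - D1. unobs_parents M v)"
    then have "u \<in> A"
      using sep fam(2)[of D1] fam(2)[of "D - D1"] by blast
    moreover have "u \<in> unobserved M"
      using u by (auto simp: unobs_parents_def)
    ultimately show False
      using A obs disjoint_observed by blast
  qed
  have split: "fac D = (\<lambda>x. fac D1 x * fac (D - D1) x)"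
    using fac_Un_indep[OF sub lat] D1 by (auto simp: Un_absorb1)
  have "pr A a = msum (D - A) (fac D) a"
    by (rule pr_ancestral[OF D A])
  also have "D - A = (D \<inter> ?F D1 - A) \<union> (D - ?F D1 - A)"
    by auto
  also have "msum \<dots> (fac D) a = msum (D \<inter> ?F D1 - A) (fac D1) a * msum (D - ?F D1 - A) (fac (D - D1)) a"
    unfolding split
    by (rule msum_prod[OF _ _ _ depends_fac _ depends_fac])
      (use fin fam(1)[of D1] fam(1)[of "D - D1"] sep in blast)+
  finally show ?thesis .
qed

text \<open>On sets between \<open>C\<close> and \<open>D\<close>, \<open>pr\<close> is a product of
  a term that ignores \<open>B\<close> and a term that ignores \<open>A\<close>. Stated without
  division, the identity also covers null events.\<close>

lemma pr_conditional_independence: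
  assumes D: "ancestral D" and D1: "D1 \<subseteq> D" and sub: "A \<subseteq> D" "B \<subseteq> D" "C \<subseteq> D"
    and sep: "(\<Union>v\<in>D1. family (edges M) v) \<inter> (\<Union>v\<in>D - D1. family (edges M) v) \<subseteq> C"
    and A: "A \<inter> (\<Union>v\<in>D - D1. family (edges M) v) \<subseteq> C"
    and B: "B \<inter> (\<Union>v\<in>D1. family (edges M) v) \<subseteq> C"
  shows "pr (A \<union> B \<union> C) a * pr C a = pr (A \<union> C) a * pr (B \<union> C) a"
proof -
  let ?F = "\<lambda>D. \<Union>v\<in>D. family (edges M) v"
  let ?f = "\<lambda>X. msum (D \<inter> ?F D1 - X) (fac D1) a"
  let ?g = "\<lambda>X. msum (D - ?F D1 - X) (fac (D - D1)) a"
  have eq: "pr X a = ?f X * ?g X" if "C \<subseteq> X" "X \<subseteq> D" for X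
    using pr_factorization[OF D D1 that(2)] sep that(1) by blast
  have self: "x \<in> D \<Longrightarrow> x \<notin> ?F D1 \<Longrightarrow> x \<in> ?F (D - D1)" for x
    by (auto simp: family_def)
  have 1: "?f (A \<union> B \<union> C) = ?f (A \<union> C)" "?f (B \<union> C) = ?f C"
    using B by (intro arg_cong[of _ _ "\<lambda>X. msum X _ _"]; blast)+
  have 2: "?g (A \<union> B \<union> C) = ?g (B \<union> C)" "?g (A \<union> C) = ?g C"
    using A self by (intro arg_cong[of _ _ "\<lambda>X. msum X _ _"]; blast)+
  have "pr (A \<union> B \<union> C) a = ?f (A \<union> C) * ?g (B \<union> C)" "pr C a = ?f C * ?g C"
    "pr (A \<union> C) a = ?f (A \<union> C) * ?g C" "pr (B \<union> C) a = ?f C * ?g (B \<union> C)"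
    using sub by (subst eq; simp add: 1 2)+
  then show ?thesis
    by (simp add: ac_simps)
qed

lemma ancestral_ancestors:
  "S \<subseteq> observed M \<Longrightarrow> ancestral (ancestors (edges M) S \<inter> observed M)"
  unfolding ancestral_def obs_parents_def using ancestors_step[of _ _ "edges M" S] by blast

lemma global_markov:
  assumes sep: "d_separated M A B C" and sub: "A \<subseteq> observed M" "B \<subseteq> observed M" "C \<subseteq> observed M"
  shows "pr (A \<union> B \<union> C) a * pr C a = pr (A \<union> C) a * pr (B \<union> C) a"
proof -
  let ?E = "edges M"
  define K where "K = conn ?E C A"
  define D where "D = ancestors ?E (A \<union> B \<union> C) \<inter> observed M"
  \<comment> \<open>The factors connected to \<open>A\<close> given \<open>C\<close>: their scopes
    stay inside \<open>K\<close> and \<open>C\<close>, while the remaining scopes avoid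
    \<open>K\<close>.\<close>
  define D1 where "D1 = {v \<in> D. family ?E v \<inter> K \<noteq> {}}"
  have KB: "K \<inter> B = {}"
    unfolding K_def
    by (rule conn_disjoint_if_d_separated[OF sep acyclic_edges edges_nodes])
      (use sub in \<open>auto simp: nodes_def\<close>)
  have step: "family ?E v \<subseteq> K \<union> C" if "v \<in> D1" for v
  proof
    fix w' assume w': "w' \<in> family ?E v"
    from that obtain w where v: "v \<in> D" and w: "w \<in> K" "w \<in> family ?E v"
      by (auto simp: D1_def)
    \<comment> \<open>\<open>conn_family\<close> does not cover a factor that is an ancestor of
      \<open>B\<close> only, but there the connection would run down to \<open>B\<close>.\<close>
    have "v \<in> ancestors ?E (A \<union> C)"
    proof (rule ccontr)
      assume "v \<notin> ancestors ?E (A \<union> C)"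
      then have "v \<in> ancestors ?E B" and nC: "v \<notin> ancestors ?E C"
        using v by (auto simp: D_def ancestors_Un)
      then obtain y where "y \<in> B" "(v, y) \<in> ?E\<^sup>*"
        by (auto simp: ancestors_def)
      then show False
        using conn_family_descend[OF w[unfolded K_def] _ nC] KB by (auto simp: K_def)
    qed
    then show "w' \<in> K \<union> C"
      using conn_family[OF w[unfolded K_def] w'] by (auto simp: K_def)
  qed
  have AK: "A \<subseteq> K \<union> C"
    using reach.start[of _ A ?E C] by (auto simp: K_def conn_def)
  show ?thesis
  proof (rule pr_conditional_independence[of D D1])
    show "ancestral D"
      unfolding D_def using sub by (intro ancestral_ancestors) auto
    show "D1 \<subseteq> D" by (auto simp: D1_def)
    show "A \<subseteq> D" "B \<subseteq> D" "C \<subseteq> D"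
      using sub subset_ancestors[of "A \<union> B \<union> C" ?E] by (auto simp: D_def)
    show "(\<Union>v\<in>D1. family ?E v) \<inter> (\<Union>v\<in>D - D1. family ?E v) \<subseteq> C"
      using step by (fastforce simp: D1_def)
    show "A \<inter> (\<Union>v\<in>D - D1. family ?E v) \<subseteq> C"
      using AK by (fastforce simp: D1_def)
    show "B \<inter> (\<Union>v\<in>D1. family ?E v) \<subseteq> C"
      using step KB by blast
  qed
qed

end

section \<open>The intervention model\<close>

text \<open>The single-world intervention graph: \<open>t\<close> keeps its own mechanism, while its children receive
  the value \<open>\<tau>\<close> instead of the value of \<open>t\<close>.\<close>

definition swig :: "('n, 'b, 'c) smcm \<Rightarrow> 'n \<Rightarrow> 'b \<Rightarrow> ('n, 'b, 'c) smcm" where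
  "swig M t \<tau> = M\<lparr>edges := {(v, w) \<in> edges M. v \<noteq> t},
     kernel := \<lambda>v x u. kernel M v (if (t, v) \<in> edges M then x(t := \<tau>) else x) u\<rparr>"

lemma swig_simps [simp]:
  "observed (swig M t \<tau>) = observed M" "unobserved (swig M t \<tau>) = unobserved M"
  "nodes (swig M t \<tau>) = nodes M" "edges (swig M t \<tau>) = {(v, w) \<in> edges M. v \<noteq> t}"
  "latent_law (swig M t \<tau>) = latent_law M" "latent_space (swig M t \<tau>) = latent_space M"
  "obs_parents (swig M t \<tau>) v = obs_parents M v - {t}"
  by (auto simp: swig_def nodes_def obs_parents_def)

lemma kernel_swig:
  "kernel (swig M t \<tau>) v x u = kernel M v (if (t, v) \<in> edges M then x(t := \<tau>) else x) u"
  by (simp add: swig_def)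

context markovian_model
begin

lemma unobs_parents_swig [simp]:
  "t \<in> observed M \<Longrightarrow> unobs_parents (swig M t \<tau>) v = unobs_parents M v"
  using disjoint_observed by (auto simp: unobs_parents_def)

lemma markovian_swig:
  assumes t: "t \<in> observed M"
  shows "markovian_model (swig M t \<tau>)"
proof
  have ac: "acyclic {(v, w) \<in> edges M. v \<noteq> t}"
    by (rule acyclic_subset[OF acyclic_edges]) auto
  have meas: "(\<lambda>u. pmf (kernel (swig M t \<tau>) v x u) c)
      \<in> borel_measurable (PiM (unobs_parents (swig M t \<tau>) v) (latent_space (swig M t \<tau>)))"
    if v: "v \<in> observed M" and x: "x \<in> PiE (obs_parents M v - {t}) (\<lambda>_. UNIV)" for v x c
  proof -
    let ?x = "if (t, v) \<in> edges M then x(t := \<tau>) else x"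
    have "?x \<in> PiE (obs_parents M v) (\<lambda>_. UNIV)"
      using x t by (auto simp: PiE_iff extensional_def obs_parents_def)
    then have "(\<lambda>u. pmf (kernel M v ?x u) c)
        \<in> borel_measurable (PiM (unobs_parents M v) (latent_space M))"
      using semi_markovian v unfolding semi_markovian_def by blast
    then show ?thesis
      using t by (simp add: kernel_swig)
  qed
  show "semi_markovian (swig M t \<tau>)"
    unfolding semi_markovian_def swig_simps
    using semi_markovian[unfolded semi_markovian_def] ac meas by auto
qed

text \<open>The case \<open>v = t\<close> is kept apart because there \<open>x t\<close> is the
  output, not an input, of the mechanism.\<close>

lemma mechanism_swig:
  assumes t: "t \<in> observed M"
  shows "mechanism (swig M t \<tau>) v x u = mechanism M v (if v = t then x else x(t := \<tau>)) u"
proof -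
  let ?x = "if v = t then x else x(t := \<tau>)"
  have "(if (t, v) \<in> edges M then (restrict x (obs_parents M v - {t}))(t := \<tau>)
      else restrict x (obs_parents M v - {t})) = restrict ?x (obs_parents M v)"
    using t edge_irrefl by (auto simp: fun_eq_iff obs_parents_def restrict_def)
  moreover have "?x v = x v"
    by simp
  ultimately show ?thesis
    using t by (simp only: mechanism_def kernel_swig swig_simps unobs_parents_swig)
qed

end

section \<open>Comparison of the observational and the intervention law\<close>

abbreviation fac_swig where "fac_swig M t \<tau> \<equiv> markovian_model.fac (swig M t \<tau>)"
abbreviation pr_swig where "pr_swig M t \<tau> \<equiv> markovian_model.pr (swig M t \<tau>)"

context markovian_model
begin

text \<open>Only children of \<open>t\<close> see the change. The first alternative gives agreement
  of the laws where \<open>t\<close> has the value \<tau>, the second the insensitivity of the other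
  factors to \<tau>.\<close>

lemma fac_swig_eq:
  assumes "t \<in> observed M" and "x t = \<tau> \<or> D \<inter> children M t = {}" and "D \<subseteq> observed M"
  shows "fac_swig M t \<tau> D x = fac D x"
proof -
  interpret S: markovian_model "swig M t \<tau>"
    by (rule markovian_swig) fact
  have "mechanism (swig M t \<tau>) v x u = mechanism M v x u" if "v \<in> D" for v u
    unfolding mechanism_swig[OF assms(1)] using assms that
    by (intro mechanism_cong) (auto simp: obs_parents_def children_def nodes_def split: if_splits)
  then show ?thesis
    by (simp add: fac_def S.fac_def)
qed

lemma pr_swig_eq:
  assumes "t \<in> A" "A \<subseteq> observed M" "a t = \<tau>"
  shows "pr_swig M t \<tau> A a = pr A a"
proof -
  interpret S: markovian_model "swig M t \<tau>"
    by (rule markovian_swig) (use assms in auto)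
  show ?thesis
    unfolding S.pr_def pr_def swig_simps using assms by (intro msum_cong fac_swig_eq) auto
qed

text \<open>The truncated factorization is a marginal of the intervention model: there
  \<open>t\<close> is a sink, so summing over it deletes its own factor.\<close>

lemma causal_effect_eq:
  assumes t: "t \<in> observed M" and y: "y \<in> observed M" and ne: "t \<noteq> y" and a: "a y = \<eta>"
  shows "causal_effect M t y \<tau> \<eta> = enn2real (pr_swig M t \<tau> {y} a)"
proof -
  interpret S: markovian_model "swig M t \<tau>"
    by (rule markovian_swig) fact
  let ?V = "observed M"
  have fin: "finite (?V - {y} - {t})" "finite {t}"
    using finite_observed by auto
  have split: "msum (?V - {y}) f a = msum (?V - {y} - {t}) (msum {t} f) a"
    for f :: "('n \<Rightarrow> 'b) \<Rightarrow> ennreal" and a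
  proof -
    have "(?V - {y} - {t}) \<union> {t} = ?V - {y}"
      using t ne by auto
    then show ?thesis
      using msum_Un[OF fin, of f a] by simp
  qed
  have nn: "0 \<le> do_prob M {t} (\<lambda>_. \<tau>) x" for x
    by (auto simp: do_prob_def intro!: integral_nonneg_AE prod_nonneg)
  have do: "ennreal (do_prob M {t} (\<lambda>_. \<tau>) x) = of_bool (x t = \<tau>) * fac (?V - {t}) x" for x
  proof -
    have "(\<Prod>v\<in>?V - {t}. mechanism M v x u) \<le> 1" for u
      by (intro prod_le_1) (auto simp: mechanism_def pmf_le_1)
    then have "integrable (latent_law M) (\<lambda>u. \<Prod>v\<in>?V - {t}. mechanism M v x u)"
      by (intro integrable_const_bound[of _ 1] AE_I2 borel_measurable_prod measurable_mechanism)
        (auto simp: prod_nonneg)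
    then have "ennreal (\<integral>u. (\<Prod>v\<in>?V - {t}. mechanism M v x u) \<partial>latent_law M) = fac (?V - {t}) x"
      unfolding fac_def
      by (subst nn_integral_eq_integral[symmetric]) (auto simp: prod_nonneg prod_ennreal)
    then show ?thesis
      by (simp add: do_prob_def)
  qed
  have dep: "depends_only_on ?V (\<lambda>x. of_bool (x t = \<tau>) * fac (?V - {t}) x)"
    unfolding depends_only_on_def
  proof (intro allI impI)
    fix x x' :: "'n \<Rightarrow> 'b"
    assume eq: "\<forall>v\<in>?V. x v = x' v"
    have "fac (?V - {t}) x = fac (?V - {t}) x'"
      by (rule depends_only_onD[OF depends_fac]) (use eq in \<open>auto simp: obs_parents_def\<close>)
    then show "of_bool (x t = \<tau>) * fac (?V - {t}) x = of_bool (x' t = \<tau>) * fac (?V - {t}) x'"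
      using eq t by simp
  qed
  \<comment> \<open>Both sides equal the product without the factor of \<open>t\<close>, evaluated
    at \<tau>: on the left the indicator selects \<tau>, on the right the sink \<open>t\<close> is
    summed out.\<close>
  have inner: "msum {t} (\<lambda>x. of_bool (x t = \<tau>) * fac (?V - {t}) x) a =
      msum {t} (fac_swig M t \<tau> ?V) a" for a
  proof -
    have anc: "S.ancestral (?V - {t})"
      by (auto simp: S.ancestral_def obs_parents_def)
    have "msum {t} (\<lambda>x. of_bool (x t = \<tau>) * fac (?V - {t}) x) a =
        (\<integral>\<^sup>+c. of_bool (c = \<tau>) * fac (?V - {t}) (a(t := c)) \<partial>count_space UNIV)"
      using msum_insert[of "{}" t "\<lambda>x. of_bool (x t = \<tau>) * fac (?V - {t}) x" a] by simp
    also have "\<dots> = (\<integral>\<^sup>+c. fac (?V - {t}) (a(t := \<tau>)) * indicator {\<tau>} c \<partial>count_space UNIV)"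
      by (intro nn_integral_cong) (auto simp: indicator_def)
    also have "\<dots> = fac (?V - {t}) (a(t := \<tau>))"
      by (simp add: nn_integral_cmult_indicator)
    also have "\<dots> = fac_swig M t \<tau> (?V - {t}) (a(t := \<tau>))"
      using t by (intro fac_swig_eq[symmetric]) auto
    \<comment> \<open>In the intervention graph \<open>t\<close> is nobody's parent, so its
      coordinate can be changed back.\<close>
    also have "\<dots> = fac_swig M t \<tau> (?V - {t}) a"
      by (rule depends_only_onD[OF S.depends_fac]) auto
    also have "\<dots> = msum {t} (fac_swig M t \<tau> ?V) a"
      using S.fac_marginal[OF anc S.ancestral_observed] t by (simp add: double_diff)
    finally show ?thesis .
  qed
  have "causal_effect M t y \<tau> \<eta> = enn2real (\<integral>\<^sup>+x. ennreal (do_prob M {t} (\<lambda>_. \<tau>) x)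
      \<partial>count_space {x \<in> PiE ?V (\<lambda>_. UNIV). x y = \<eta>})"
    unfolding causal_effect_def using nn by (rule infsum_nonneg_eq_nn_integral)
  also have "(\<integral>\<^sup>+x. ennreal (do_prob M {t} (\<lambda>_. \<tau>) x) \<partial>count_space {x \<in> PiE ?V (\<lambda>_. UNIV). x y = \<eta>})
      = (\<integral>\<^sup>+x. (of_bool (x t = \<tau>) * fac (?V - {t}) x) * indicator {x. \<forall>v\<in>{y}. x v = a v} x
        \<partial>count_space (PiE ?V (\<lambda>_. UNIV)))"
    using a by (auto simp: do nn_integral_count_space_indicator indicator_def intro!: nn_integral_cong)
  also have "\<dots> = msum (?V - {y}) (\<lambda>x. of_bool (x t = \<tau>) * fac (?V - {t}) x) a"
    using y by (intro nn_integral_agreeing_msum dep) simp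
  also have "\<dots> = msum (?V - {y} - {t}) (msum {t} (\<lambda>x. of_bool (x t = \<tau>) * fac (?V - {t}) x)) a"
    by (rule split)
  also have "\<dots> = msum (?V - {y} - {t}) (msum {t} (fac_swig M t \<tau> ?V)) a"
    by (rule msum_cong) (rule inner)
  also have "\<dots> = pr_swig M t \<tau> {y} a"
    unfolding S.pr_def swig_simps by (rule split[symmetric])
  finally show ?thesis .
qed

end

section \<open>Front-door adjustment\<close>

lemma (in markovian_model) children_observed: "children M t \<subseteq> observed M"
  using no_latent_target by (auto simp: children_def nodes_def)

lemma (in markovian_model) mem_children_iff: "v \<in> children M t \<longleftrightarrow> (t, v) \<in> edges M"
  using edges_nodes by (auto simp: children_def)

locale front_door = markovian_model M
  for M :: "('n, 'b :: countable, 'c) smcm" +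
  fixes t y :: 'n and b z zo zi :: "'n set"
  assumes t: "t \<in> observed M" and y: "y \<in> observed M" and t_neq_y: "t \<noteq> y"
    and y_descendant: "descendant M y t"
    and confounded: "bidirected M t y"
    and b_def: "b = children M t"
    and z: "z \<subseteq> observed M - ({t} \<union> b \<union> {y})"
    and zo: "zo \<subseteq> z" and zi: "zi = z - zo"
    and sep_b: "d_separated M b {y} ({t} \<union> z)"
    and sep_zi: "d_separated M zi {t} {}"
    and sep_zo: "d_separated M zo {t} (b \<union> zi)"
begin

section \<open>Graphical consequences of the separation hypotheses\<close>

abbreviation "E \<equiv> edges M"
abbreviation "Es \<equiv> {(v, w) \<in> edges M. v \<noteq> t}"

lemma b_observed: "b \<subseteq> observed M" and mem_b: "v \<in> b \<longleftrightarrow> (t, v) \<in> E"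
  by (simp_all add: b_def children_observed mem_children_iff)

lemma t_notin: "t \<notin> b" "t \<notin> z" "t \<notin> zi"
  using z zi edge_irrefl by (auto simp: mem_b)

lemma z_b_disjoint: "z \<inter> b = {}" "zi \<inter> b = {}"
  using z zi by auto

lemma conn_b: "y \<notin> conn E ({t} \<union> z) b"
  using conn_disjoint_if_d_separated[OF sep_b acyclic_edges edges_nodes] b_observed
  by (auto simp: nodes_def)

lemma conn_t: "conn E (b \<union> zi) {t} \<inter> zo = {}"
  by (rule conn_disjoint_if_d_separated[OF d_separated_sym[OF sep_zo] acyclic_edges edges_nodes])
    (use t in \<open>auto simp: nodes_def\<close>)

lemma y_notin: "y \<notin> b" "y \<notin> z" "y \<notin> zi"
  using conn_b z zi t_neq_y reach.start[of y b E "{t} \<union> z"] by (auto simp: conn_def)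

text \<open>With nothing conditioned on, a common ancestor gives a fork that nothing blocks.\<close>

lemma no_common_ancestor_zi: "ancestors E zi \<inter> ancestors E {t} = {}"
proof (rule equals0I)
  fix w assume w: "w \<in> ancestors E zi \<inter> ancestors E {t}"
  have none: "w \<notin> ancestors E {}"
    by (simp add: ancestors_def)
  have "w \<in> conn E {} zi"
    using reach_ancestors_source[OF _ none] w by (auto simp: conn_def)
  moreover have "(w, t) \<in> E\<^sup>*"
    using w by (auto simp: ancestors_def)
  ultimately have "t \<in> conn E {} zi"
    using none by (rule conn_descend)
  moreover have "conn E {} zi \<inter> {t} = {}"
    by (rule conn_disjoint_if_d_separated[OF sep_zi acyclic_edges edges_nodes])
      (use z zi in \<open>auto simp: nodes_def\<close>)
  ultimately show False by blast
qed

lemma ancestor_t_notin_b: "w \<in> ancestors E {t} \<Longrightarrow> w \<notin> b"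
  using acyclic_edges unfolding ancestors_def mem_b acyclic_def
  by (auto dest: rtrancl_into_trancl2)

text \<open>Climbing from \<open>t\<close> meets neither \<open>b\<close>, by acyclicity, nor
  \<open>zi\<close>, so all ancestors of \<open>t\<close> are connected to it given
  \<open>b \<union> zi\<close>. Hence none of them lies in \<open>zo\<close>.\<close>

lemma ancestor_t:
  assumes "w \<in> ancestors E {t}"
  shows "w \<in> conn E (b \<union> zi) {t}" and "w \<notin> b \<union> z"
proof -
  have "(w, t) \<in> E\<^sup>*"
    using assms by (auto simp: ancestors_def)
  then have "reach E (b \<union> zi) {t} False w \<and> w \<notin> b \<union> zi"
  proof (induction rule: converse_rtrancl_induct)
    case base
    then show ?case using t_notin by (auto intro: reach.start)
  next
    case (step v w)
    then have v: "v \<in> ancestors E {t}"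
      by (auto simp: ancestors_def)
    then have "v \<notin> zi"
      using no_common_ancestor_zi subset_ancestors[of zi E] by blast
    then show ?case
      using step reach.up[of E "b \<union> zi" "{t}" False w v] ancestor_t_notin_b[OF v] by auto
  qed
  then show "w \<in> conn E (b \<union> zi) {t}"
    by (auto simp: conn_def)
  then show "w \<notin> b \<union> z"
    using conn_t zi by (auto simp: conn_def)
qed

lemma Es_t_sink: "(t, v) \<in> Es\<^sup>* \<Longrightarrow> v = t"
  by (erule converse_rtranclE) auto

text \<open>Climbs from \<open>v\<close> to \<open>w\<close> while avoiding
  \<open>{t} \<union> z\<close>: \<open>t\<close> is a sink of \<open>Es\<close>, no node on the way
  is in \<open>zi\<close>, and none is in \<open>zo\<close> because the connection of
  \<open>w\<close> to \<open>t\<close> is carried down the path. A node of \<open>b\<close> on the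
  way restarts both connections.\<close>

lemma reach_b_up:
  assumes "(w, v) \<in> Es\<^sup>*" and "v \<in> b"
    and "w \<notin> ancestors E zi" and "w \<in> conn E (b \<union> zi) {t} \<union> b"
  shows "reach E ({t} \<union> z) b False w"
  using assms(1,3,4)
proof (induction rule: converse_rtrancl_induct)
  case base
  then show ?case using assms(2) by (auto intro: reach.start)
next
  case (step w w')
  show ?case
  proof (cases "w \<in> b")
    case True
    then show ?thesis by (rule reach.start)
  next
    case False
    then have w: "w \<in> conn E (b \<union> zi) {t}" and e: "(w, w') \<in> E"
      using step by auto
    have "w' \<notin> ancestors E zi"
      using step.prems e ancestors_step[of w w' E zi] by blast
    moreover from this have "w' \<notin> zi"
      using subset_ancestors[of zi E] by blast
    moreover from this have w': "w' \<in> conn E (b \<union> zi) {t} \<union> b"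
      using w e by (auto simp: conn_def intro: reach.down)
    moreover have "w' \<noteq> t"
      using Es_t_sink[of v] step.hyps(2) assms(2) t_notin by auto
    moreover have "w' \<notin> z"
      using w' conn_t \<open>w' \<notin> zi\<close> zi z_b_disjoint by auto
    ultimately show ?thesis
      using step.IH reach.up[of E "{t} \<union> z" b False w' w] e by simp
  qed
qed

text \<open>The nodes on the way down are ancestors of \<open>t\<close>, hence outside
  \<open>z\<close>. The final flag records the arrow into \<open>t\<close> that makes it a collider
  for the next edge.\<close>

lemma reach_t_down:
  assumes "(w, t) \<in> E\<^sup>*" and "reach E ({t} \<union> z) b d w" and "w \<noteq> t"
  shows "reach E ({t} \<union> z) b True t"
  using assms
proof (induction arbitrary: d rule: converse_rtrancl_induct)
  case (step w w')
  then have "w \<in> ancestors E {t}"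
    by (auto simp: ancestors_def)
  then have "w \<notin> {t} \<union> z"
    using ancestor_t(2) step.prems by auto
  then have "reach E ({t} \<union> z) b True w'"
    using step by (auto intro: reach.down)
  then show ?case
    using step.IH by (cases "w' = t") auto
qed simp

text \<open>A common ancestor of \<open>t\<close> and \<open>b\<close> would connect \<open>b\<close> to the collider \<open>t\<close>, and on to
  \<open>y\<close> through the confounder. This is where confounding of \<open>t\<close> and \<open>y\<close> is needed.\<close>

lemma no_common_ancestor: "ancestors Es {t} \<inter> ancestors Es (b \<union> zi) = {}"
proof (rule equals0I)
  fix w assume w: "w \<in> ancestors Es {t} \<inter> ancestors Es (b \<union> zi)"
  have mono: "ancestors Es S \<subseteq> ancestors E S" for S
    by (rule ancestors_mono) auto
  have wt: "w \<in> ancestors E {t}" "w \<notin> ancestors E zi"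
    using w mono[of "{t}"] no_common_ancestor_zi by auto
  then obtain v where v: "v \<in> b" "(w, v) \<in> Es\<^sup>*"
    using w mono[of zi] by (auto simp: ancestors_def)
  have "reach E ({t} \<union> z) b False w"
    using reach_b_up[OF v(2,1)] wt ancestor_t by blast
  moreover have "w \<noteq> t"
    using Es_t_sink[of v] v t_notin by auto
  ultimately have r: "reach E ({t} \<union> z) b True t"
    using reach_t_down wt(1) by (auto simp: ancestors_def)
  obtain u where u: "u \<in> unobserved M" "(u, t) \<in> E" "(u, y) \<in> E"
    using confounded by (auto simp: bidirected_def unobs_parents_def)
  have "reach E ({t} \<union> z) b False u"
    using reach.up[OF r _ u(2)] subset_ancestors[of "{t} \<union> z" E] by simp
  moreover have "u \<notin> {t} \<union> z"
    using u(1) t z disjoint_observed by blast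
  ultimately have "reach E ({t} \<union> z) b True y"
    using u(3) by (rule reach.down)
  then show False
    using conn_b t_neq_y y_notin by (auto simp: conn_def)
qed

section \<open>Independence and invariance under the intervention law\<close>

lemma family_ancestors:
  "v \<in> ancestors F S \<Longrightarrow> family F v \<subseteq> ancestors F S"
  using ancestors_step[of _ v F S] by (auto simp: family_def)

text \<open>Conditional independence with empty conditioning set: the scopes of the two groups of
  factors lie in the two disjoint ancestor sets.\<close>

lemma pr_swig_independent:
  "pr_swig M t \<tau> ({t} \<union> (b \<union> zi)) a = pr_swig M t \<tau> {t} a * pr_swig M t \<tau> (b \<union> zi) a"
proof -
  interpret S: markovian_model "swig M t \<tau>"
    by (rule markovian_swig[OF t])
  define D where "D = ancestors Es ({t} \<union> (b \<union> zi)) \<inter> observed M"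
  define D1 where "D1 = ancestors Es {t} \<inter> observed M"
  have anc: "S.ancestral D"
    unfolding D_def using S.ancestral_ancestors[of "{t} \<union> (b \<union> zi)"] t b_observed z zi by auto
  have sub: "{t} \<union> (b \<union> zi) \<subseteq> D"
    unfolding D_def using t b_observed z zi subset_ancestors[of "{t} \<union> (b \<union> zi)" Es] by auto
  have F1: "(\<Union>v\<in>D1. family Es v) \<subseteq> ancestors Es {t}"
    using family_ancestors by (fastforce simp: D1_def)
  have F2: "(\<Union>v\<in>D - D1. family Es v) \<subseteq> ancestors Es (b \<union> zi)"
  proof (intro UN_least family_ancestors)
    fix v assume "v \<in> D - D1"
    then show "v \<in> ancestors Es (b \<union> zi)"
      unfolding D_def D1_def ancestors_Un[of Es "{t}" "b \<union> zi"] by blast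
  qed
  have "S.pr ({t} \<union> (b \<union> zi) \<union> {}) a * S.pr {} a = S.pr ({t} \<union> {}) a * S.pr ((b \<union> zi) \<union> {}) a"
  proof (rule S.pr_conditional_independence[OF anc, of D1]; (unfold swig_simps)?)
    show "D1 \<subseteq> D"
      unfolding D_def D1_def ancestors_Un[of Es "{t}" "b \<union> zi"] by blast
    show "{t} \<subseteq> D" "b \<union> zi \<subseteq> D" "{} \<subseteq> D"
      using sub by auto
    show "(\<Union>v\<in>D1. family Es v) \<inter> (\<Union>v\<in>D - D1. family Es v) \<subseteq> {}"
      using F1 F2 no_common_ancestor by blast
    show "{t} \<inter> (\<Union>v\<in>D - D1. family Es v) \<subseteq> {}"
      using F2 no_common_ancestor subset_ancestors[of "{t}" Es] by blast
    show "(b \<union> zi) \<inter> (\<Union>v\<in>D1. family Es v) \<subseteq> {}"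
      using F1 no_common_ancestor subset_ancestors[of "b \<union> zi" Es] by blast
  qed
  then show ?thesis by simp
qed

text \<open>By acyclicity no child of \<open>t\<close> is among its ancestors, so the factors that
  determine the law of \<open>t\<close> do not see \<tau>.\<close>

lemma pr_swig_t: "pr_swig M t \<tau> {t} a = pr {t} a"
proof -
  interpret S: markovian_model "swig M t \<tau>"
    by (rule markovian_swig[OF t])
  define D where "D = ancestors E {t} \<inter> observed M"
  have D: "ancestral D" "{t} \<subseteq> D"
    unfolding D_def using ancestral_ancestors[of "{t}"] t subset_ancestors[of "{t}" E] by auto
  then have "S.ancestral D"
    by (auto simp: S.ancestral_def ancestral_def)
  then have "S.pr {t} a = msum (D - {t}) (S.fac D) a"
    using D(2) by (rule S.pr_ancestral)
  also have "\<dots> = msum (D - {t}) (fac D) a"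
    using ancestor_t_notin_b b_def by (intro msum_cong fac_swig_eq t) (auto simp: D_def)
  also have "\<dots> = pr {t} a"
    by (rule pr_ancestral[OF D, symmetric])
  finally show ?thesis .
qed

text \<open>Since \<open>t\<close> has a descendant it has a child, and every ancestor of
  \<open>t\<close> is an ancestor of that child.\<close>

lemma ancestors_t_b: "ancestors E {t} \<subseteq> ancestors E b"
proof -
  obtain v where "(t, v) \<in> E"
    using y_descendant by (auto simp: descendant_def elim: converse_tranclE)
  then have "t \<in> ancestors E b"
    using ancestors_step[of t v E b] subset_ancestors[of b E] mem_b by blast
  then show ?thesis
    using ancestors_idem[of _ E t b] by blast
qed

text \<open>\<open>conn_family\<close> applies to both connections once \<open>v\<close> is an
  ancestor of \<open>b \<union> zi\<close>. Otherwise \<open>v\<close> is an ancestor of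
  \<open>y\<close>; it is none of \<open>zo\<close>, as the connection to \<open>t\<close> would
  descend there, and then the connection to \<open>b\<close> descends to \<open>y\<close>.\<close>

lemma conn_both_family:
  assumes v: "v \<in> ancestors Es (b \<union> zi \<union> {t, y})"
    and w: "w \<in> conn E (b \<union> zi) {t} \<inter> conn E ({t} \<union> z) b" "w \<in> family Es v"
    and w': "w' \<in> family Es v" "w' \<notin> b \<union> zi \<union> {t}"
  shows "w' \<in> conn E (b \<union> zi) {t} \<inter> conn E ({t} \<union> z) b"
proof -
  have fam: "w \<in> family E v" "w' \<in> family E v"
    using w w' by (auto simp: family_def)
  have "v \<in> ancestors E (b \<union> zi)"
  proof (rule ccontr)
    assume n: "v \<notin> ancestors E (b \<union> zi)"
    have "v \<in> ancestors E (b \<union> zi \<union> {t, y})"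
      using v ancestors_mono[of Es E "b \<union> zi \<union> {t, y}" "b \<union> zi \<union> {t, y}"] by auto
    then have "v \<in> ancestors E {t} \<union> ancestors E {y}"
      using n by (auto simp: ancestors_def)
    moreover have nt: "v \<notin> ancestors E {t}"
      using n ancestors_t_b by (auto simp: ancestors_Un)
    ultimately have vy: "(v, y) \<in> E\<^sup>*"
      by (auto simp: ancestors_def)
    have "v \<notin> ancestors E zo"
      using conn_family_descend[OF _ fam(1) _ n, of "{t}"] w(1) conn_t by (auto simp: ancestors_def)
    then have "v \<notin> ancestors E ({t} \<union> z)"
      using n nt zi zo by (auto simp: ancestors_def)
    then have "y \<in> conn E ({t} \<union> z) b"
      using conn_family_descend[OF _ fam(1) vy, of "{t} \<union> z" b] w(1) by blast
    then show False using conn_b by simp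
  qed
  then have a: "v \<in> ancestors E ({t} \<union> (b \<union> zi))" "v \<in> ancestors E (b \<union> ({t} \<union> z))"
    using zi by (auto simp: ancestors_def)
  have 1: "w' \<in> conn E (b \<union> zi) {t}"
    using conn_family[OF _ fam _ a(1)] w(1) w'(2) by blast
  then have "w' \<notin> {t} \<union> z"
    using conn_t w'(2) zi by auto
  then show ?thesis
    using 1 conn_family[OF _ fam _ a(2)] w(1) by blast
qed

text \<open>A parent \<open>w\<close> of a child \<open>v\<close> of \<open>t\<close> is connected
  to \<open>t\<close> through the collider \<open>v\<close>, which lies in the conditioning set, and
  to \<open>b\<close> directly from \<open>v\<close>.\<close>

lemma conn_both_b:
  assumes v: "v \<in> b" and w: "w \<in> family Es v" "w \<notin> b \<union> zi \<union> {t}"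
  shows "w \<in> conn E (b \<union> zi) {t} \<inter> conn E ({t} \<union> z) b"
proof -
  have e: "(w, v) \<in> E" "(t, v) \<in> E"
    using v w by (auto simp: family_def mem_b)
  have "reach E (b \<union> zi) {t} True v"
    using reach.down[OF reach.start, of t "{t}" "b \<union> zi" v E] e t_notin by auto
  then have "reach E (b \<union> zi) {t} False w"
    using reach.up[of E "b \<union> zi" "{t}" True v w] e v subset_ancestors[of "b \<union> zi" E] by auto
  then have 1: "w \<in> conn E (b \<union> zi) {t}"
    using w(2) by (auto simp: conn_def)
  then have "w \<notin> {t} \<union> z"
    using conn_t w(2) zi by auto
  moreover have "v \<notin> {t} \<union> z"
    using v t_notin z_b_disjoint by auto
  then have "reach E ({t} \<union> z) b False w"
    using reach.up[of E "{t} \<union> z" b False v w] reach.start[of v b E "{t} \<union> z"] v e by simp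
  ultimately show ?thesis
    using 1 by (auto simp: conn_def)
qed

text \<open>\<open>D1\<close> collects the factors that are linked to the factors of \<open>b\<close>, the only ones in which
  \<open>\<tau>\<close> occurs; \<open>y\<close> does not occur in them.\<close>

lemma pr_swig_invariant:
  fixes \<tau> \<tau>' :: 'b
  defines "C \<equiv> b \<union> zi \<union> {t}"
  shows "pr_swig M t \<tau> (insert y C) a * pr_swig M t \<tau>' C a =
    pr_swig M t \<tau>' (insert y C) a * pr_swig M t \<tau> C a"
proof -
  \<comment> \<open>Connection to \<open>t\<close> keeps \<open>zo\<close> out of \<open>K\<close>,
    connection to \<open>b\<close> keeps \<open>y\<close> out.\<close>
  define K where "K = conn E (b \<union> zi) {t} \<inter> conn E ({t} \<union> z) b"
  define D where "D = ancestors Es (b \<union> zi \<union> {t, y}) \<inter> observed M"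
  define D1 where "D1 = {v \<in> D. v \<in> b \<or> family Es v \<inter> K \<noteq> {}}"
  let ?F = "\<lambda>D. \<Union>v\<in>D. family Es v"
  have step: "family Es v \<subseteq> K \<union> C" if "v \<in> D1" for v
    using that conn_both_family[of v] conn_both_b[of v] unfolding D1_def D_def K_def C_def by blast
  have sep: "?F D1 \<inter> ?F (D - D1) \<subseteq> C"
    using step by (fastforce simp: D1_def)
  have CD: "insert y C \<subseteq> D"
    using t y b_observed z zi subset_ancestors[of "b \<union> zi \<union> {t, y}" Es]
    by (auto simp: D_def C_def)
  have yF: "y \<notin> ?F D1"
    using step conn_b y_notin t_neq_y by (force simp: K_def C_def)
  \<comment> \<open>The first factor is the same for both choices of \<open>X\<close>, as
    \<open>y\<close> does not occur in it; the second is free of \<tau>, as it has no mechanism of a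
    child of \<open>t\<close>. Cross-multiplication then cancels the dependence on \<tau>.\<close>
  have fac: "pr_swig M t \<tau> X a = msum (D \<inter> ?F D1 - C) (fac_swig M t \<tau> D1) a *
      msum (D - ?F D1 - X) (fac (D - D1)) a" if "X \<in> {C, insert y C}" for X \<tau>
  proof -
    interpret S: markovian_model "swig M t \<tau>"
      by (rule markovian_swig[OF t])
    have "S.ancestral D"
      unfolding D_def using S.ancestral_ancestors[of "b \<union> zi \<union> {t, y}"] t y b_observed z zi by auto
    then have "S.pr X a = msum (D \<inter> ?F D1 - X) (S.fac D1) a * msum (D - ?F D1 - X) (S.fac (D - D1)) a"
      using S.pr_factorization[of D D1 X a] that CD sep by (auto simp: D1_def)
    moreover have "D \<inter> ?F D1 - X = D \<inter> ?F D1 - C"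
      using that yF by auto
    moreover have "S.fac (D - D1) = fac (D - D1)"
      by (intro ext fac_swig_eq t) (auto simp: D1_def D_def b_def)
    ultimately show ?thesis by simp
  qed
  show ?thesis
    by (simp add: fac ac_simps)
qed

end

section \<open>Real-valued marginals and the algebra of the summands\<close>

context markovian_model
begin

definition pr_real :: "'n set \<Rightarrow> ('n \<Rightarrow> 'b) \<Rightarrow> real" where
  "pr_real A a = enn2real (pr A a)"

lemma ennreal_pr_real: "A \<subseteq> observed M \<Longrightarrow> ennreal (pr_real A a) = pr A a"
  unfolding pr_real_def using pr_le_1[of A a] by (intro ennreal_enn2real) (auto simp: top.not_eq_extremum order_le_less_trans)

lemma pr_real_nonneg [simp]: "0 \<le> pr_real A a"
  by (simp add: pr_real_def)

lemma pr_real_mono: "A \<subseteq> B \<Longrightarrow> B \<subseteq> observed M \<Longrightarrow> pr_real B a \<le> pr_real A a"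
  using pr_mono[of A B a] by (simp flip: ennreal_le_iff add: ennreal_pr_real)

lemma pr_real_cong: "(\<And>v. v \<in> A \<Longrightarrow> a v = a' v) \<Longrightarrow> pr_real A a = pr_real A a'"
  unfolding pr_real_def using depends_only_onD[OF depends_pr] by metis

lemma measure_obs_law_pr_real: "A \<subseteq> observed M \<Longrightarrow> \<P>(x in obs_law M. agrees A a x) = pr_real A a"
  by (simp add: pr_real_def measure_obs_law)

text \<open>Rewrites the two real sums as one nested \<open>msum\<close>. The coordinate
  \<open>t\<close> of the summation variable carries the inner value of the treatment and is reset
  to \<tau> in the weight; \<open>a0\<close> serves to fix \<open>y\<close>.\<close>

lemma front_door_formula_eq:
  assumes A: "A \<subseteq> observed M - {t, y}" and t: "t \<in> observed M" and y: "y \<in> observed M"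
    and ne: "t \<noteq> y" and a0: "a0 y = \<eta>"
  shows "front_door_formula M A t y \<tau> \<eta> = enn2real (msum A (msum {t} (\<lambda>a. ennreal (
    pr_real (insert y (insert t A)) a / pr_real (insert t A) a * pr_real {t} a *
    (pr_real (insert t A) (a(t := \<tau>)) / pr_real {t} (a(t := \<tau>)))))) a0)"
proof -
  define T where "T a = pr_real (insert y (insert t A)) a / pr_real (insert t A) a * pr_real {t} a" for a
  define R where "R a = pr_real (insert t A) (a(t := \<tau>)) / pr_real {t} (a(t := \<tau>))" for a
  have sub: "insert y (insert t A) \<subseteq> observed M" "insert t A \<subseteq> observed M" "{t} \<subseteq> observed M"
    using A t y by auto
  define g where "g a c = (override_on a0 a A)(t := c)" for a c
  have g: "g a c t = c" "g a c y = \<eta>" "v \<in> A \<Longrightarrow> g a c v = a v" for a c v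
    using A ne a0 by (auto simp: g_def override_on_def)
  have P1: "\<P>(x in obs_law M. x y = \<eta> \<and> agrees A a x \<and> x t = c) = pr_real (insert y (insert t A)) (g a c)" for a c
    using g by (subst measure_obs_law_pr_real[OF sub(1), symmetric])
      (auto intro!: arg_cong[of _ _ "measure (obs_law M)"])
  have P2: "\<P>(x in obs_law M. agrees A a x \<and> x t = c) = pr_real (insert t A) (g a c)" for a c
    using g by (subst measure_obs_law_pr_real[OF sub(2), symmetric])
      (auto intro!: arg_cong[of _ _ "measure (obs_law M)"])
  have P3: "\<P>(x in obs_law M. x t = c) = pr_real {t} (g a c)" for a c
    using g by (subst measure_obs_law_pr_real[OF sub(3), symmetric])
      (auto intro!: arg_cong[of _ _ "measure (obs_law M)"])
  have T0: "0 \<le> T a" "0 \<le> R a" for a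
    by (simp_all add: T_def R_def)
  have T1: "T a \<le> pr_real {t} a" for a
  proof -
    have "pr_real (insert y (insert t A)) a / pr_real (insert t A) a \<le> 1"
      unfolding divide_le_eq_1 using pr_real_mono[OF subset_insertI sub(1), of a] pr_real_nonneg[of "insert t A" a]
      by linarith
    then have "pr_real (insert y (insert t A)) a / pr_real (insert t A) a * pr_real {t} a \<le> 1 * pr_real {t} a"
      by (intro mult_right_mono pr_real_nonneg)
    then show ?thesis
      by (simp only: T_def mult_1)
  qed
  \<comment> \<open>The inner sum is bounded by the total mass \<open>1\<close> of the law of
    \<open>t\<close>, so it is finite and passing through \<open>infsum\<close> loses
    nothing.\<close>
  have inner: "ennreal (\<Sum>\<^sub>\<infinity>c. T (g a c)) = (\<integral>\<^sup>+c. ennreal (T (g a c)) \<partial>count_space UNIV)" for a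
  proof -
    have "(\<integral>\<^sup>+c. ennreal (T (g a c)) \<partial>count_space UNIV) \<le> (\<integral>\<^sup>+c. pr {t} (g a c) \<partial>count_space UNIV)"
      using T1 by (intro nn_integral_mono) (simp flip: ennreal_pr_real[OF sub(3)])
    also have "\<dots> = msum {t} (pr {t}) (override_on a0 a A)"
      by (simp add: msum_singleton g_def)
    also have "\<dots> = 1"
      using pr_sum[of "{}" "{t}"] sub(3) by simp
    finally have "(\<integral>\<^sup>+c. ennreal (T (g a c)) \<partial>count_space UNIV) \<noteq> \<infinity>"
      by (auto simp: top_unique)
    then show ?thesis
      using T0 by (subst infsum_nonneg_eq_nn_integral) (auto simp: less_top)
  qed
  have R: "R (g a c) = pr_real (insert t A) (g a \<tau>) / pr_real {t} (g a \<tau>)" for a c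
    by (simp add: R_def g_def)
  have "front_door_formula M A t y \<tau> \<eta> =
      (\<Sum>\<^sub>\<infinity>a\<in>PiE A (\<lambda>_. UNIV). (\<Sum>\<^sub>\<infinity>c. T (g a c)) * R (g a \<tau>))"
    unfolding front_door_formula_def cond_prob_def P1 P2 T_def R
    by (intro infsum_cong arg_cong2[of _ _ _ _ "(*)"] arg_cong2[of _ _ _ _ "(/)"] refl P3)
  also have "\<dots> = enn2real (\<integral>\<^sup>+a. ennreal ((\<Sum>\<^sub>\<infinity>c. T (g a c)) * R (g a \<tau>)) \<partial>count_space (PiE A (\<lambda>_. UNIV)))"
    using T0 by (intro infsum_nonneg_eq_nn_integral mult_nonneg_nonneg infsum_nonneg) auto
  also have "(\<integral>\<^sup>+a. ennreal ((\<Sum>\<^sub>\<infinity>c. T (g a c)) * R (g a \<tau>)) \<partial>count_space (PiE A (\<lambda>_. UNIV))) =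
      msum A (msum {t} (\<lambda>a. ennreal (T a * R a))) a0"
    unfolding msum_def[of A]
  proof (intro nn_integral_cong)
    fix a
    have "ennreal ((\<Sum>\<^sub>\<infinity>c. T (g a c)) * R (g a \<tau>)) =
        (\<integral>\<^sup>+c. ennreal (T (g a c)) \<partial>count_space UNIV) * ennreal (R (g a \<tau>))"
      using T0 by (subst ennreal_mult) (auto intro!: infsum_nonneg simp: inner)
    also have "\<dots> = (\<integral>\<^sup>+c. ennreal (T (g a c)) * ennreal (R (g a \<tau>)) \<partial>count_space UNIV)"
      by (simp add: nn_integral_multc)
    also have "\<dots> = (\<integral>\<^sup>+c. ennreal (T (g a c) * R (g a c)) \<partial>count_space UNIV)"
      unfolding ennreal_mult[OF T0(1) T0(2)] unfolding R ..
    finally show "ennreal ((\<Sum>\<^sub>\<infinity>c. T (g a c)) * R (g a \<tau>)) =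
        msum {t} (\<lambda>a. ennreal (T a * R a)) (override_on a0 a A)"
      by (simp add: msum_singleton g_def)
  qed
  finally show ?thesis
    by (simp only: T_def R_def)
qed

lemma adjustment_definedD:
  assumes def: "adjustment_defined M A t" and A: "A \<subseteq> observed M - {t}" and t: "t \<in> observed M"
    and pos: "pr_real (insert t A) (a(t := \<tau>)) > 0" "pr_real {t} a > 0"
  shows "pr_real (insert t A) a > 0"
proof -
  have sub: "insert t A \<subseteq> observed M" "{t} \<subseteq> observed M"
    using A t by auto
  have P: "\<P>(x in obs_law M. agrees A (restrict a A) x \<and> x t = c) = pr_real (insert t A) (a(t := c))" for c
    using A by (subst measure_obs_law_pr_real[OF sub(1), symmetric])
      (auto intro!: arg_cong[of _ _ "measure (obs_law M)"])
  have "\<P>(x in obs_law M. x t = a t) = pr_real {t} a"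
    by (subst measure_obs_law_pr_real[OF sub(2), symmetric]) simp
  then have "\<P>(x in obs_law M. agrees A (restrict a A) x \<and> x t = \<tau>) > 0 \<and> \<P>(x in obs_law M. x t = a t) > 0"
    using pos P by simp
  moreover have "restrict a A \<in> PiE A (\<lambda>_. UNIV)"
    by simp
  ultimately have "\<P>(x in obs_law M. agrees A (restrict a A) x \<and> x t = a t) > 0"
    using def unfolding adjustment_defined_def by blast
  then show ?thesis
    using P[of "a t"] by simp
qed

end

text \<open>\<open>P\<close> is observational, \<open>Q\<close> interventional, and a prime marks
  \<open>t\<close> reset to \<tau>. If \<open>Pst\<close> is \<open>0\<close>, then
  \<open>pos\<close> forces \<open>Qst\<close>, hence \<open>Qsty\<close>, to be \<open>0\<close>,
  and division by zero makes the left side \<open>0\<close> as well.\<close>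

lemma s_term_identity:
  fixes Psty Pst Pt Pst' Pt' Qsty Qst Qs :: real
  assumes "Pt' > 0" "Pst' = Qs * Pt'" "Qst = Pt * Qs" "Qsty * Pst = Psty * Qst"
    and "0 \<le> Qsty" "Qsty \<le> Qst" "0 \<le> Pst" "0 \<le> Qs" "0 \<le> Pt"
    and pos: "Pst' > 0 \<Longrightarrow> Pt > 0 \<Longrightarrow> Pst > 0"
  shows "Psty / Pst * Pt * (Pst' / Pt') = Qsty"
proof (cases "Pst = 0")
  case True
  have "Pst' = 0 \<or> Pt = 0"
    using pos assms True by (metis less_eq_real_def less_irrefl mult_nonneg_nonneg)
  then have "Qst = 0"
    using assms(1,2,3) by auto
  then have "Qsty = 0"
    using assms(5,6) by linarith
  then show ?thesis
    using True by simp
next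
  case False
  then have "Psty / Pst * Pt * (Pst' / Pt') = Psty * Qst / Pst"
    using assms by (simp add: field_simps)
  also have "\<dots> = Qsty"
    using False assms(4) by (simp add: field_simps)
  finally show ?thesis .
qed

text \<open>With positive weights the two independences are solved for \<open>Pzbt\<close> and
  \<open>Pzbt'\<close>. If \<open>Pt\<close>, \<open>Pst'\<close> or \<open>Pzb\<close> is
  \<open>0\<close>, monotonicity makes both sides vanish.\<close>

lemma z_term_identity:
  fixes Pzty Pzt Pt Pt' Pzbty Pzbt Pzbt' Pst Pst' Ps Pzb :: real
  assumes "Pt' > 0"
    and "Pzbty * Pzt = Pzbt * Pzty" "Pzbt * Ps = Pzb * Pst" "Pzbt' * Ps = Pzb * Pst'"
    and pos: "Pst' > 0 \<Longrightarrow> Pt > 0 \<Longrightarrow> Pst > 0"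
    and nonneg: "0 \<le> Pt" "0 \<le> Pst'" "0 \<le> Pzb" "0 \<le> Pzbt'" "0 \<le> Pzbty"
    and mono: "Pzbt' \<le> Pst'" "Pzbt \<le> Pzt" "Pst \<le> Ps" "Pzbt' \<le> Pzb'" "Pzb' = Pzb" "Pzbty \<le> Pzb"
  shows "Pzty / Pzt * Pt / Pt' * Pzbt' = Pzbty * (Pt * Pst' / (Pst * Pt'))"
proof -
  consider "Pt = 0" | "Pst' = 0" | "Pzb = 0" | "Pt > 0" "Pst' > 0" "Pzb > 0"
    using nonneg by linarith
  then show ?thesis
  proof cases
    case 4
    then have st: "Pst > 0" "Ps > 0"
      using pos mono by auto
    have zbt: "Pzbt = Pzb * Pst / Ps" "Pzbt' = Pzb * Pst' / Ps"
      using assms(3,4) st by (auto simp: field_simps)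
    then have "Pzbt > 0"
      using 4 st by simp
    then have zt: "Pzt > 0" "Pzty / Pzt = Pzbty / Pzbt"
      using mono assms(2) by (auto simp: field_simps)
    show ?thesis
      unfolding zt(2) unfolding zbt using 4 st assms(1) by (simp add: field_simps)
  qed (use nonneg mono in auto)
qed

section \<open>The two adjustment formulas\<close>

context front_door
begin

abbreviation "s \<equiv> b \<union> zi"

lemma s_observed: "s \<subseteq> observed M - {t, y}" and z_observed: "z \<subseteq> observed M - {t, y}"
  using b_observed z zi t_notin y_notin by auto

text \<open>Independence and invariance turn each summand into a joint probability of
  \<open>y\<close>, \<open>s\<close> and \<open>t\<close> under the intervention law.\<close>

lemma s_term:
  assumes adj: "adjustment_defined M s t" and pos: "0 < \<P>(x in obs_law M. x t = \<tau>)"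
  shows "pr_real (insert y (insert t s)) a / pr_real (insert t s) a * pr_real {t} a *
      (pr_real (insert t s) (a(t := \<tau>)) / pr_real {t} (a(t := \<tau>))) =
    markovian_model.pr_real (swig M t \<tau>) (insert y (insert t s)) a"
proof -
  interpret S: markovian_model "swig M t \<tau>"
    by (rule markovian_swig[OF t])
  have sub: "insert y (insert t s) \<subseteq> observed M" "insert t s \<subseteq> observed M" "{t} \<subseteq> observed M"
    using s_observed t y by auto
  have ind: "S.pr_real (insert t s) a = pr_real {t} a * S.pr_real s a" for a
    using pr_swig_independent[of \<tau> a] by (simp add: S.pr_real_def pr_real_def pr_swig_t enn2real_mult)
  have eq: "pr_swig M t (a t) A a = pr A a" if "t \<in> A" "A \<subseteq> observed M" for A
    using that by (intro pr_swig_eq) auto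
  have tau: "S.pr_real A (a(t := \<tau>)) = pr_real A (a(t := \<tau>))" if "t \<in> A" "A \<subseteq> observed M" for A
    using that by (simp add: S.pr_real_def pr_real_def pr_swig_eq)
  show ?thesis
  proof (rule s_term_identity[where Qs = "S.pr_real s a" and Qst = "S.pr_real (insert t s) a"])
    show "0 < pr_real {t} (a(t := \<tau>))"
      using pos measure_obs_law_pr_real[OF sub(3), of "a(t := \<tau>)"] by simp
    have "S.pr_real s (a(t := \<tau>)) = S.pr_real s a"
      using s_observed by (intro S.pr_real_cong) auto
    then show "pr_real (insert t s) (a(t := \<tau>)) = S.pr_real s a * pr_real {t} (a(t := \<tau>))"
      using ind[of "a(t := \<tau>)"] tau[of "insert t s"] sub by (simp add: mult.commute)
    show "S.pr_real (insert t s) a = pr_real {t} a * S.pr_real s a"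
      by (rule ind)
    \<comment> \<open>Taking \<open>a t\<close> as the second intervention value makes the second
      law agree with the observational one at \<open>a\<close>.\<close>
    show "S.pr_real (insert y (insert t s)) a * pr_real (insert t s) a =
        pr_real (insert y (insert t s)) a * S.pr_real (insert t s) a"
      using pr_swig_invariant[of \<tau> a "a t"] eq[of "insert t s"] eq[of "insert y (insert t s)"] sub
      by (simp add: S.pr_real_def pr_real_def flip: enn2real_mult)
    show "S.pr_real (insert y (insert t s)) a \<le> S.pr_real (insert t s) a"
      using sub by (intro S.pr_real_mono) auto
    show "0 < pr_real (insert t s) a" if "0 < pr_real (insert t s) (a(t := \<tau>))" "0 < pr_real {t} a"
      using s_observed by (intro adjustment_definedD[OF adj _ t that]) auto
  qed simp_all
qed

text \<open>By \<open>s_term\<close> the sum over \<open>s\<close> and \<open>t\<close> is a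
  marginalization, which leaves the intervention law of \<open>y\<close>.\<close>

lemma s_front_door:
  assumes adj: "adjustment_defined M s t" and pos: "0 < \<P>(x in obs_law M. x t = \<tau>)"
  shows "causal_effect M t y \<tau> \<eta> = front_door_formula M s t y \<tau> \<eta>"
proof -
  interpret S: markovian_model "swig M t \<tau>"
    by (rule markovian_swig[OF t])
  define a0 :: "'n \<Rightarrow> 'b" where "a0 = (\<lambda>_. \<eta>)"
  have sub: "{y} \<union> (s \<union> {t}) \<subseteq> observed M" and fin: "finite s" "finite {t}"
    using s_observed t y finite_observed by (auto intro: finite_subset[of _ "observed M"])
  have set: "insert y (insert t s) = {y} \<union> (s \<union> {t})"
    by auto
  have "front_door_formula M s t y \<tau> \<eta> =
      enn2real (msum s (msum {t} (S.pr ({y} \<union> (s \<union> {t})))) a0)"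
    unfolding front_door_formula_eq[OF s_observed t y t_neq_y, of a0 \<eta>, OF a0_def[THEN fun_cong]]
      s_term[OF adj pos]
    unfolding set using sub by (simp only: S.ennreal_pr_real swig_simps)
  also have "\<dots> = enn2real (S.pr {y} a0)"
    using S.pr_sum[of "{y}" "s \<union> {t}" a0] sub msum_Un[OF fin, of "S.pr ({y} \<union> (s \<union> {t}))" a0]
      t_neq_y t_notin y_notin by auto
  also have "\<dots> = causal_effect M t y \<tau> \<eta>"
    by (rule causal_effect_eq[symmetric, OF t y t_neq_y]) (simp add: a0_def)
  finally show ?thesis by simp
qed

text \<open>Expands the weight of \<open>z\<close> over the values of \<open>b\<close>. The two
  conditional independences turn each summand into a joint probability times a ratio that depends
  only on \<open>t\<close> and \<open>s\<close>.\<close>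

lemma z_term:
  assumes adj: "adjustment_defined M s t" and pos: "0 < \<P>(x in obs_law M. x t = \<tau>)"
  shows "ennreal (pr_real (insert y (insert t z)) a / pr_real (insert t z) a * pr_real {t} a *
      (pr_real (insert t z) (a(t := \<tau>)) / pr_real {t} (a(t := \<tau>)))) =
    msum b (\<lambda>x. ennreal (pr_real (insert y (insert t (z \<union> b))) x *
      (pr_real {t} x * pr_real (insert t s) (x(t := \<tau>)) / (pr_real (insert t s) x * pr_real {t} (x(t := \<tau>)))))) a"
proof -
  \<comment> \<open>The part of the term that is constant in \<open>b\<close> and can be moved into
    the sum.\<close>
  define c where "c x = pr_real (insert y (insert t z)) x / pr_real (insert t z) x * pr_real {t} x /
    pr_real {t} (x(t := \<tau>))" for x
  have sub: "insert y (insert t (z \<union> b)) \<subseteq> observed M" "insert t z \<subseteq> observed M"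
      "insert t (z \<union> b) \<subseteq> observed M" "insert t s \<subseteq> observed M" "z \<union> b \<subseteq> observed M" "s \<subseteq> observed M"
    using s_observed z_observed t y by auto
  have c0: "0 \<le> c x" for x
    by (simp add: c_def)
  have dep: "depends_only_on (insert y (insert t z)) (\<lambda>x. ennreal (c x))"
    unfolding depends_only_on_def
  proof (intro allI impI)
    fix x x' :: "'n \<Rightarrow> 'b"
    assume "\<forall>v\<in>insert y (insert t z). x v = x' v"
    then have "pr_real (insert y (insert t z)) x = pr_real (insert y (insert t z)) x'"
      "pr_real (insert t z) x = pr_real (insert t z) x'" "pr_real {t} x = pr_real {t} x'"
      "pr_real {t} (x(t := \<tau>)) = pr_real {t} (x'(t := \<tau>))"
      by (intro pr_real_cong; auto)+
    then show "ennreal (c x) = ennreal (c x')"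
      by (simp add: c_def)
  qed
  have CI1: "pr_real (insert y (insert t (z \<union> b))) x * pr_real (insert t z) x =
      pr_real (insert t (z \<union> b)) x * pr_real (insert y (insert t z)) x" for x
  proof -
    have "{t} \<union> z = insert t z" "b \<union> {y} \<union> insert t z = insert y (insert t (z \<union> b))"
      "b \<union> insert t z = insert t (z \<union> b)" "{y} \<union> insert t z = insert y (insert t z)"
      by auto
    note sets = this
    have "pr (insert y (insert t (z \<union> b))) x * pr (insert t z) x =
        pr (insert t (z \<union> b)) x * pr (insert y (insert t z)) x"
      using global_markov[OF sep_b b_observed, of x] sub unfolding sets by simp
    then show ?thesis
      by (simp only: pr_real_def flip: enn2real_mult)
  qed
  have zb: "zo \<union> s = z \<union> b"
    using zo zi by auto
  \<comment> \<open>Independence of \<open>zo\<close> and \<open>t\<close> given \<open>s\<close>,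
    used below both at \<open>x\<close> and with \<open>t\<close> reset to \<tau>.\<close>
  have CI2: "pr_real (insert t (z \<union> b)) x * pr_real s x = pr_real (z \<union> b) x * pr_real (insert t s) x" for x
  proof -
    have "zo \<union> {t} \<union> s = insert t (z \<union> b)" "{t} \<union> s = insert t s"
      using zb by auto
    note sets = zb this
    have "pr (insert t (z \<union> b)) x * pr s x = pr (z \<union> b) x * pr (insert t s) x"
      using global_markov[OF sep_zo, of x] sub t order_trans[OF zo] unfolding sets by simp
    then show ?thesis
      by (simp only: pr_real_def flip: enn2real_mult)
  qed
  have key: "c x * pr_real (insert t (z \<union> b)) (x(t := \<tau>)) = pr_real (insert y (insert t (z \<union> b))) x *
      (pr_real {t} x * pr_real (insert t s) (x(t := \<tau>)) / (pr_real (insert t s) x * pr_real {t} (x(t := \<tau>))))" for x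
    unfolding c_def
  proof (rule z_term_identity)
    show "0 < pr_real {t} (x(t := \<tau>))"
      using pos measure_obs_law_pr_real[of "{t}" "x(t := \<tau>)"] t by simp
    show "pr_real (insert y (insert t (z \<union> b))) x * pr_real (insert t z) x =
        pr_real (insert t (z \<union> b)) x * pr_real (insert y (insert t z)) x"
      by (rule CI1)
    show "pr_real (insert t (z \<union> b)) x * pr_real s x = pr_real (z \<union> b) x * pr_real (insert t s) x"
      by (rule CI2)
    have s0: "pr_real s (x(t := \<tau>)) = pr_real s x"
      using s_observed by (intro pr_real_cong) auto
    show zb0: "pr_real (z \<union> b) (x(t := \<tau>)) = pr_real (z \<union> b) x"
      using s_observed z_observed by (intro pr_real_cong) auto
    show "pr_real (insert t (z \<union> b)) (x(t := \<tau>)) * pr_real s x = pr_real (z \<union> b) x * pr_real (insert t s) (x(t := \<tau>))"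
      using CI2[of "x(t := \<tau>)"] s0 zb0 by simp
    show "0 < pr_real (insert t s) x" if "0 < pr_real (insert t s) (x(t := \<tau>))" "0 < pr_real {t} x"
      using s_observed by (intro adjustment_definedD[OF adj _ t that]) auto
    show "pr_real (insert t (z \<union> b)) (x(t := \<tau>)) \<le> pr_real (insert t s) (x(t := \<tau>))"
      using sub zi by (intro pr_real_mono) auto
    show "pr_real (insert t (z \<union> b)) x \<le> pr_real (insert t z) x"
      using sub by (intro pr_real_mono) auto
    show "pr_real (insert t s) x \<le> pr_real s x"
      using sub by (intro pr_real_mono) auto
    show "pr_real (insert t (z \<union> b)) (x(t := \<tau>)) \<le> pr_real (z \<union> b) (x(t := \<tau>))"
      using sub by (intro pr_real_mono) auto
    show "pr_real (insert y (insert t (z \<union> b))) x \<le> pr_real (z \<union> b) x"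
      using sub by (intro pr_real_mono) auto
  qed simp_all
  have "insert t z \<union> b = insert t (z \<union> b)"
    by auto
  then have "msum b (pr (insert t (z \<union> b))) (a(t := \<tau>)) = pr (insert t z) (a(t := \<tau>))"
    using pr_sum[of "insert t z" b "a(t := \<tau>)"] sub t_notin z_b_disjoint by auto
  then have marg: "msum b (\<lambda>x. pr (insert t (z \<union> b)) (x(t := \<tau>))) a = pr (insert t z) (a(t := \<tau>))"
    using t_notin by (simp add: msum_fun_upd)
  have "ennreal (pr_real (insert y (insert t z)) a / pr_real (insert t z) a * pr_real {t} a *
      (pr_real (insert t z) (a(t := \<tau>)) / pr_real {t} (a(t := \<tau>)))) = ennreal (c a * pr_real (insert t z) (a(t := \<tau>)))"
    by (simp add: c_def)
  also have "\<dots> = ennreal (c a) * msum b (\<lambda>x. pr (insert t (z \<union> b)) (x(t := \<tau>))) a"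
    using c0 sub by (simp add: ennreal_mult ennreal_pr_real marg)
  also have "\<dots> = msum b (\<lambda>x. ennreal (c x) * pr (insert t (z \<union> b)) (x(t := \<tau>))) a"
    using t_notin y_notin z_b_disjoint by (intro msum_mult_left[symmetric, OF dep]) auto
  also have "\<dots> = msum b (\<lambda>x. ennreal (c x * pr_real (insert t (z \<union> b)) (x(t := \<tau>)))) a"
    using c0 sub by (simp add: ennreal_mult ennreal_pr_real)
  finally show ?thesis
    by (simp only: key)
qed

text \<open>Since \<open>z \<union> b = s \<union> zo\<close>, both formulas sum the same function
  \<open>?r\<close> in different orders: summing out \<open>b\<close> first gives the terms for
  \<open>z\<close>, summing out \<open>zo\<close> first those for \<open>s\<close>.\<close>

lemma z_formula_eq_s_formula:
  assumes adj: "adjustment_defined M s t" and pos: "0 < \<P>(x in obs_law M. x t = \<tau>)"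
  shows "front_door_formula M z t y \<tau> \<eta> = front_door_formula M s t y \<tau> \<eta>"
proof -
  define a0 :: "'n \<Rightarrow> 'b" where "a0 = (\<lambda>_. \<eta>)"
  define k where "k x = pr_real {t} x * pr_real (insert t s) (x(t := \<tau>)) / (pr_real (insert t s) x * pr_real {t} (x(t := \<tau>)))"
    for x
  let ?r = "\<lambda>x. ennreal (pr_real (insert y (insert t (z \<union> b))) x * k x)"
  have sub: "insert y (insert t (z \<union> b)) \<subseteq> observed M" "insert y (insert t s) \<subseteq> observed M"
    using s_observed z_observed t y by auto
  have fin: "finite z" "finite {t}" "finite b" "finite s" "finite zo"
    using sub zo finite_observed by (auto intro: finite_subset[of _ "observed M"])
  have k0: "0 \<le> k x" for x
    by (simp add: k_def)
  have dep: "depends_only_on (insert t s) (\<lambda>x. ennreal (k x))"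
    unfolding depends_only_on_def
  proof (intro allI impI)
    fix x x' :: "'n \<Rightarrow> 'b"
    assume "\<forall>v\<in>insert t s. x v = x' v"
    then have "pr_real (insert t s) x = pr_real (insert t s) x'" "pr_real {t} x = pr_real {t} x'"
      "pr_real (insert t s) (x(t := \<tau>)) = pr_real (insert t s) (x'(t := \<tau>))"
      "pr_real {t} (x(t := \<tau>)) = pr_real {t} (x'(t := \<tau>))"
      by (intro pr_real_cong; auto)+
    then show "ennreal (k x) = ennreal (k x')"
      by (simp add: k_def)
  qed
  have dis: "zo \<inter> insert t s = {}" "zo \<inter> insert y (insert t s) = {}"
    using zo zi t_notin y_notin z_b_disjoint by auto
  have un: "insert y (insert t s) \<union> zo = insert y (insert t (z \<union> b))"
    using zo zi by auto
  \<comment> \<open>The ratio \<open>k\<close> is constant in \<open>zo\<close>, so only the joint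
    probability is marginalized.\<close>
  have s_sum: "msum zo ?r x = ennreal (pr_real (insert y (insert t s)) x / pr_real (insert t s) x * pr_real {t} x *
      (pr_real (insert t s) (x(t := \<tau>)) / pr_real {t} (x(t := \<tau>))))" for x
  proof -
    have "msum zo ?r x = msum zo (\<lambda>x. ennreal (k x) * pr (insert y (insert t (z \<union> b))) x) x"
      using k0 sub by (simp add: ennreal_mult ennreal_pr_real mult.commute)
    also have "\<dots> = ennreal (k x) * msum zo (pr (insert y (insert t (z \<union> b)))) x"
      using dis by (intro msum_mult_left[OF dep]) auto
    also have "\<dots> = ennreal (k x) * pr (insert y (insert t s)) x"
      using pr_sum[of "insert y (insert t s)" zo x] un sub dis z_observed zo by (auto simp: Int_commute)
    also have "\<dots> = ennreal (pr_real (insert y (insert t s)) x * k x)"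
      using k0 sub by (simp add: ennreal_mult ennreal_pr_real mult.commute)
    finally show ?thesis
      by (simp add: k_def)
  qed
  have "msum z (msum {t} (msum b ?r)) a0 = msum (z \<union> ({t} \<union> b)) ?r a0"
    using fin t_notin z_b_disjoint by (intro msum_Un3[symmetric]) auto
  also have "z \<union> ({t} \<union> b) = s \<union> ({t} \<union> zo)"
    using zo zi by auto
  also have "msum \<dots> ?r a0 = msum s (msum {t} (msum zo ?r)) a0"
    using fin t_notin z_b_disjoint zi zo by (intro msum_Un3) auto
  finally have eq: "msum z (msum {t} (msum b ?r)) a0 = msum s (msum {t} (msum zo ?r)) a0" .
  have "front_door_formula M z t y \<tau> \<eta> = enn2real (msum z (msum {t} (msum b ?r)) a0)"
    unfolding front_door_formula_eq[OF z_observed t y t_neq_y, of a0 \<eta>, OF a0_def[THEN fun_cong]]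
      z_term[OF adj pos] k_def ..
  also have "\<dots> = front_door_formula M s t y \<tau> \<eta>"
    unfolding front_door_formula_eq[OF s_observed t y t_neq_y, of a0 \<eta>, OF a0_def[THEN fun_cong]]
      eq s_sum ..
  finally show ?thesis .
qed

end

theorem theorem2:
  fixes M :: "('n, 'b :: countable, 'c) smcm"
    and t y :: 'n and b z zo zi s :: "'n set"
  assumes "semi_markovian M" and "faithful M"
    and "t \<in> observed M" and "y \<in> observed M" and "t \<noteq> y"
    and "descendant M y t"
    and "bidirected M t y"
    and "b = children M t" and "b \<subseteq> observed M"
    and "z \<subseteq> observed M - ({t} \<union> b \<union> {y})"
    and "d_separated M b {y} ({t} \<union> z)"
    and "zo \<subseteq> z" and "zi = z - zo"
    and "d_separated M zi {t} {}"
    and "d_separated M zo {t} (b \<union> zi)"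
    and "s = b \<union> zi"
    and "adjustment_defined M z t" and "adjustment_defined M s t"
  shows "generalized_front_door M z t y \<and> generalized_front_door M s t y \<and>
    (\<forall>\<tau> \<eta>. \<P>(x in obs_law M. x t = \<tau>) > 0 \<longrightarrow>
       causal_effect M t y \<tau> \<eta> =
         (\<Sum>\<^sub>\<infinity>zv\<in>PiE z (\<lambda>_. UNIV).
            (\<Sum>\<^sub>\<infinity>\<tau>'. \<P>(x in obs_law M. x y = \<eta> \<bar> agrees z zv x \<and> x t = \<tau>') *
                   \<P>(x in obs_law M. x t = \<tau>')) *
            \<P>(x in obs_law M. agrees z zv x \<bar> x t = \<tau>)) \<and>
       causal_effect M t y \<tau> \<eta> =
         (\<Sum>\<^sub>\<infinity>sv\<in>PiE s (\<lambda>_. UNIV).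
            (\<Sum>\<^sub>\<infinity>\<tau>'. \<P>(x in obs_law M. x y = \<eta> \<bar> agrees s sv x \<and> x t = \<tau>') *
                   \<P>(x in obs_law M. x t = \<tau>')) *
            \<P>(x in obs_law M. agrees s sv x \<bar> x t = \<tau>)))"
proof -
  interpret F: front_door M t y b z zo zi
    using assms by unfold_locales simp_all
  have s: "causal_effect M t y \<tau> \<eta> = front_door_formula M s t y \<tau> \<eta>"
    and z: "causal_effect M t y \<tau> \<eta> = front_door_formula M z t y \<tau> \<eta>"
    if "\<P>(x in obs_law M. x t = \<tau>) > 0" for \<tau> \<eta>
    using F.s_front_door[OF _ that] F.z_formula_eq_s_formula[OF _ that] assms(16,18) by simp_all
  show ?thesis
    unfolding generalized_front_door_def front_door_formula_def[symmetric] using s z by blast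
qed

end
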